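(* Let $W_{\psi,\varphi,\max}$ be the maximal weighted composition operator on $\mathcal F^2$ induced by entire functions $\varphi,\psi$ with $\psi\not\equiv0$. The following assertions are equivalent. (1) The operator $W_{\psi,\varphi,\max}$ is normal. (2) One of the following cases occurs, for some complex constants $A,B,C,D$: (a) $\varphi(z)=Az+B$ with $A\ne1$, and $\psi(z)=Ce^{Dz}$, where $D=\overline B(1-A)(1-\overline A)^{-1}$; (b) $\varphi(z)=z+B$, and $\psi(z)=Ce^{Dz}$, where $|B|=|D|$.
   Context: The Fock space $\mathcal F^2$ is the Hilbert space of entire functions on $\mathbb C$ that are square integrable with respect to $\frac1\pi e^{-|z|^2}\,dV(z)$ ($dV$ is Lebesgue measure on $\mathbb C$), with inner product $\langle f,g\rangle=\frac1\pi\int_{\mathbb C}f(z)\overline{g(z)}e^{-|z|^2}\,dV(z)$. For entire functions $\psi,\varphi$, put $E(\psi,\varphi)f=\psi\cdot (f\circ\varphi)$. The maximal weighted composition operator $W_{\psi,\varphi,\max}$ has domain $\{f\in\mathcal F^2: E(\psi,\varphi)f\in\mathcal F^2\}$ and acts by $W_{\psi,\varphi,\max}f=E(\psi,\varphi)f$. An operator $T$ is normal if it is closed, densely defined, $\operatorname{dom}(T)=\operatorname{dom}(T^* )$ and $\|Tx\|=\|T^*x\|$ for all $x\in\operatorname{dom}(T)$. *)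

theory Defs
  imports "HOL-Complex_Analysis.Complex_Analysis"
begin

definition fock_space :: "(complex \<Rightarrow> complex) set" where
  "fock_space = {f. f holomorphic_on UNIV \<and>
     integrable lborel (\<lambda>z. (cmod (f z))\<^sup>2 * exp (- (cmod z)\<^sup>2))}"

definition fock_inner :: "(complex \<Rightarrow> complex) \<Rightarrow> (complex \<Rightarrow> complex) \<Rightarrow> complex" where
  "fock_inner f g =
     (LINT z|lborel. f z * cnj (g z) * of_real (exp (- (cmod z)\<^sup>2))) / of_real pi"

definition fock_norm :: "(complex \<Rightarrow> complex) \<Rightarrow> real" where
  "fock_norm f = sqrt (Re (fock_inner f f))"

text \<open>
  A (possibly unbounded) operator in the Fock space is a pair of its domain and its action;
  only the values of the action on the domain are relevant.
\<close>

type_synonym fock_operator =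
  "(complex \<Rightarrow> complex) set \<times> ((complex \<Rightarrow> complex) \<Rightarrow> (complex \<Rightarrow> complex))"

definition op_dom :: "fock_operator \<Rightarrow> (complex \<Rightarrow> complex) set" where
  "op_dom T = fst T"

definition op_app :: "fock_operator \<Rightarrow> (complex \<Rightarrow> complex) \<Rightarrow> (complex \<Rightarrow> complex)" where
  "op_app T = snd T"

definition densely_defined :: "fock_operator \<Rightarrow> bool" where
  "densely_defined T \<longleftrightarrow> op_dom T \<subseteq> fock_space \<and>
     (\<forall>f\<in>fock_space. \<forall>\<epsilon>>0. \<exists>g\<in>op_dom T. fock_norm (\<lambda>z. f z - g z) < \<epsilon>)"

definition closed_operator :: "fock_operator \<Rightarrow> bool" where
  "closed_operator T \<longleftrightarrow>
     (\<forall>F f g. (\<forall>n::nat. F n \<in> op_dom T) \<and> f \<in> fock_space \<and> g \<in> fock_space \<and>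
        (\<lambda>n. fock_norm (\<lambda>z. F n z - f z)) \<longlonglongrightarrow> 0 \<and>
        (\<lambda>n. fock_norm (\<lambda>z. op_app T (F n) z - g z)) \<longlonglongrightarrow> 0
        \<longrightarrow> f \<in> op_dom T \<and> op_app T f = g)"

text \<open>
  The representing element \<open>h\<close> below is unique when \<open>T\<close> is densely defined, so the adjoint is
  meaningful exactly for densely defined operators.
\<close>

definition adjoint_op :: "fock_operator \<Rightarrow> fock_operator" where
  "adjoint_op T =
     ({g \<in> fock_space. \<exists>h\<in>fock_space. \<forall>f\<in>op_dom T. fock_inner (op_app T f) g = fock_inner f h},
      \<lambda>g. THE h. h \<in> fock_space \<and> (\<forall>f\<in>op_dom T. fock_inner (op_app T f) g = fock_inner f h))"

definition normal_operator :: "fock_operator \<Rightarrow> bool" where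
  "normal_operator T \<longleftrightarrow> closed_operator T \<and> densely_defined T \<and>
     op_dom T = op_dom (adjoint_op T) \<and>
     (\<forall>f\<in>op_dom T. fock_norm (op_app T f) = fock_norm (op_app (adjoint_op T) f))"

definition weighted_comp ::
    "(complex \<Rightarrow> complex) \<Rightarrow> (complex \<Rightarrow> complex) \<Rightarrow> (complex \<Rightarrow> complex) \<Rightarrow> (complex \<Rightarrow> complex)" where
  "weighted_comp \<psi> \<phi> f = (\<lambda>z. \<psi> z * f (\<phi> z))"

definition W_max :: "(complex \<Rightarrow> complex) \<Rightarrow> (complex \<Rightarrow> complex) \<Rightarrow> fock_operator" where
  "W_max \<psi> \<phi> = ({f \<in> fock_space. weighted_comp \<psi> \<phi> f \<in> fock_space}, weighted_comp \<psi> \<phi>)"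

end

theory Submission
  imports Defs "HOL-Probability.Distributions"
begin

text \<open>
  Write \<open>K w z = exp (z * cnj w)\<close> for the reproducing kernel. The adjoint satisfies
  \<open>W* (K w) = cnj (\<psi> w) K (\<phi> w)\<close>, so if \<open>W\<close> is normal then every \<open>K w\<close> lies in its domain and
  \<open>norm (W (K w)) = norm (W* (K w))\<close>. Since point evaluations are bounded, this gives an inequality between
  \<open>\<psi> z\<close>, \<open>\<phi> z\<close>, \<open>\<psi> w\<close> and \<open>\<phi> w\<close>, from which \<open>\<psi>\<close> has no zeros. If \<open>\<phi> u = \<phi> v\<close> then a combination of \<open>K u\<close> and
  \<open>K v\<close> lies in the kernel of \<open>W*\<close>, hence of \<open>W\<close>; so \<open>\<phi>\<close> is constant or injective, hence affine, and Liouville's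
  theorem applied to the inequality makes \<open>\<psi>\<close> an exponential with the stated exponent.

  Conversely, let \<open>V\<close> be the operator obtained from \<open>W\<close> by replacing \<open>(A, B, C, D)\<close> by
  \<open>(cnj A, cnj D, cnj C, cnj B)\<close>; its action on kernels is that of \<open>W*\<close>. A rigid motion of the plane carries
  the integral for \<open>norm (W f)\<close> to that for \<open>norm (V f)\<close>, so the domains and norms agree. It remains to see
  \<open>\<langle>W f, g\<rangle> = \<langle>f, V g\<rangle>\<close> on the maximal domains. For \<open>A \<noteq> 1\<close> a translation to the fixed point of \<open>\<phi>\<close> reduces this to
  dilations, where both integrands have the same averages over circles; for \<open>A = 1\<close> it is a contour shift.
\<close>

subsection \<open>Lebesgue measure on the complex plane\<close>

lemma measurable_Complex_pair [measurable]:
  "(\<lambda>p. Complex (fst p) (snd p)) \<in> borel_measurable (borel \<Otimes>\<^sub>M borel)"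
  unfolding borel_prod complex_eq by (intro borel_measurable_continuous_onI continuous_intros)

text \<open>Lebesgue measure is determined by its values on open boxes, and an open box of the plane
  pulls back to a product of two intervals.\<close>

lemma lborel_complex_eq_distr_pair:
  "lborel = distr (lborel \<Otimes>\<^sub>M lborel) borel (\<lambda>p. Complex (fst p) (snd p))"
proof (rule lborel_eqI)
  fix l u :: complex
  assume le: "\<And>b. b \<in> Basis \<Longrightarrow> l \<bullet> b \<le> u \<bullet> b"
  have le': "Re l \<le> Re u" "Im l \<le> Im u"
    using le[of 1] le[of \<i>] by (auto simp: Basis_complex_def)
  have "(\<lambda>p. Complex (fst p) (snd p)) -` box l u = {Re l<..<Re u} \<times> {Im l<..<Im u}"
    by (auto simp: box_def Basis_complex_def)
  then show "emeasure (distr (lborel \<Otimes>\<^sub>M lborel) borel (\<lambda>p. Complex (fst p) (snd p))) (box l u)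
      = (\<Prod>b\<in>Basis. (u - l) \<bullet> b)"
    using le' by (simp add: emeasure_distr lborel.emeasure_pair_measure_Times Basis_complex_def
        ennreal_mult[symmetric] space_pair_measure)
qed simp

lemma nn_integral_lborel_complex:
  fixes f :: "complex \<Rightarrow> ennreal"
  assumes [measurable]: "f \<in> borel_measurable borel"
  shows "(\<integral>\<^sup>+z. f z \<partial>lborel) = (\<integral>\<^sup>+y. \<integral>\<^sup>+x. f (Complex x y) \<partial>lborel \<partial>lborel)"
    and "(\<integral>\<^sup>+z. f z \<partial>lborel) = (\<integral>\<^sup>+x. \<integral>\<^sup>+y. f (Complex x y) \<partial>lborel \<partial>lborel)"
proof -
  have *: "(\<integral>\<^sup>+z. f z \<partial>lborel) = (\<integral>\<^sup>+p. f (Complex (fst p) (snd p)) \<partial>(lborel \<Otimes>\<^sub>M lborel))"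
    by (subst lborel_complex_eq_distr_pair) (simp add: nn_integral_distr)
  show "(\<integral>\<^sup>+z. f z \<partial>lborel) = (\<integral>\<^sup>+y. \<integral>\<^sup>+x. f (Complex x y) \<partial>lborel \<partial>lborel)"
    unfolding * by (subst lborel_pair.nn_integral_snd[symmetric]) auto
  show "(\<integral>\<^sup>+z. f z \<partial>lborel) = (\<integral>\<^sup>+x. \<integral>\<^sup>+y. f (Complex x y) \<partial>lborel \<partial>lborel)"
    unfolding * by (subst lborel.nn_integral_fst[symmetric]) auto
qed

lemma nn_integral_lborel_translate:
  fixes f :: "'a::euclidean_space \<Rightarrow> ennreal"
  assumes [measurable]: "f \<in> borel_measurable borel"
  shows "(\<integral>\<^sup>+x. f (c + x) \<partial>lborel) = (\<integral>\<^sup>+x. f x \<partial>lborel)"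
  using nn_integral_distr[of "(+) c" lborel borel f] by (simp add: lborel_distr_plus)

text \<open>A shear translates each horizontal (or vertical) line by an amount depending on that
  line only, so integrating along these lines first reduces the claim to translation invariance on
  the real line.\<close>

lemma distr_lborel_shear:
  shows "distr lborel borel (\<lambda>z. Complex (Re z + a * Im z) (Im z)) = lborel"
    and "distr lborel borel (\<lambda>z. Complex (Re z) (Im z + a * Re z)) = lborel"
proof -
  have [measurable]: "(\<lambda>z. Complex (Re z + a * Im z) (Im z)) \<in> borel_measurable borel"
      "(\<lambda>z. Complex (Re z) (Im z + a * Re z)) \<in> borel_measurable borel"
    unfolding complex_eq by (intro borel_measurable_continuous_onI continuous_intros)+
  show "distr lborel borel (\<lambda>z. Complex (Re z + a * Im z) (Im z)) = lborel"
  proof (rule measure_eqI)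
    fix S :: "complex set"
    assume "S \<in> sets (distr lborel borel (\<lambda>z. Complex (Re z + a * Im z) (Im z)))"
    then have [measurable]: "S \<in> sets borel"
      by simp
    have [measurable]: "(\<lambda>x. Complex x y) \<in> borel_measurable borel" for y
      unfolding complex_eq by (intro borel_measurable_continuous_onI continuous_intros)
    have "emeasure (distr lborel borel (\<lambda>z. Complex (Re z + a * Im z) (Im z))) S
        = (\<integral>\<^sup>+z. indicator S (Complex (Re z + a * Im z) (Im z)) \<partial>lborel)"
      by (simp add: nn_integral_distr flip: nn_integral_indicator)
    also have "\<dots> = (\<integral>\<^sup>+y. \<integral>\<^sup>+x. indicator S (Complex (a * y + x) y) \<partial>lborel \<partial>lborel)"
      by (subst nn_integral_lborel_complex) (auto simp: add.commute)
    also have "\<dots> = (\<integral>\<^sup>+y. \<integral>\<^sup>+x. indicator S (Complex x y) \<partial>lborel \<partial>lborel)"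
      by (intro nn_integral_cong nn_integral_lborel_translate) measurable
    also have "\<dots> = emeasure lborel S"
      by (subst nn_integral_lborel_complex(1)[symmetric]) auto
    finally show "emeasure (distr lborel borel (\<lambda>z. Complex (Re z + a * Im z) (Im z))) S = emeasure lborel S" .
  qed simp
  show "distr lborel borel (\<lambda>z. Complex (Re z) (Im z + a * Re z)) = lborel"
  proof (rule measure_eqI)
    fix S :: "complex set"
    assume "S \<in> sets (distr lborel borel (\<lambda>z. Complex (Re z) (Im z + a * Re z)))"
    then have [measurable]: "S \<in> sets borel"
      by simp
    have [measurable]: "(\<lambda>y. Complex x y) \<in> borel_measurable borel" for x
      unfolding complex_eq by (intro borel_measurable_continuous_onI continuous_intros)
    have "emeasure (distr lborel borel (\<lambda>z. Complex (Re z) (Im z + a * Re z))) S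
        = (\<integral>\<^sup>+z. indicator S (Complex (Re z) (Im z + a * Re z)) \<partial>lborel)"
      by (simp add: nn_integral_distr flip: nn_integral_indicator)
    also have "\<dots> = (\<integral>\<^sup>+x. \<integral>\<^sup>+y. indicator S (Complex x (a * x + y)) \<partial>lborel \<partial>lborel)"
      by (subst nn_integral_lborel_complex(2)) (auto simp: add.commute)
    also have "\<dots> = (\<integral>\<^sup>+x. \<integral>\<^sup>+y. indicator S (Complex x y) \<partial>lborel \<partial>lborel)"
      by (intro nn_integral_cong nn_integral_lborel_translate) measurable
    also have "\<dots> = emeasure lborel S"
      by (subst nn_integral_lborel_complex(2)[symmetric]) auto
    finally show "emeasure (distr lborel borel (\<lambda>z. Complex (Re z) (Im z + a * Re z))) S = emeasure lborel S" .
  qed simp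
qed

lemma distr_lborel_comp:
  fixes f g :: "'a::euclidean_space \<Rightarrow> 'a"
  assumes "f \<in> borel_measurable borel" "g \<in> borel_measurable borel"
    and "distr lborel borel f = lborel" "distr lborel borel g = lborel"
  shows "distr lborel borel (\<lambda>x. f (g x)) = lborel"
proof -
  have "distr (distr lborel borel g) borel f = distr lborel borel (f \<circ> g)"
    using assms by (intro distr_distr) auto
  then show ?thesis
    using assms by (simp add: comp_def)
qed

(* A rotation other than by pi is a composition of three shears. *)
lemma distr_lborel_rotation:
  fixes c :: complex
  assumes "cmod c = 1"
  shows "distr lborel borel (\<lambda>z. c * z) = lborel"
proof -
  have meas: "(\<lambda>z. Complex (Re z + a * Im z) (Im z)) \<in> borel_measurable borel"
      "(\<lambda>z. Complex (Re z) (Im z + a * Re z)) \<in> borel_measurable borel" for a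
    unfolding complex_eq by (intro borel_measurable_continuous_onI continuous_intros)+
  have rot: "distr lborel borel (\<lambda>z. c * z) = lborel" if c: "cmod c = 1" "c \<noteq> -1" for c
  proof -
    have c2: "(Re c)\<^sup>2 + (Im c)\<^sup>2 = 1"
      using c(1) by (metis cmod_power2 one_power2)
    have k: "1 + Re c \<noteq> 0"
    proof
      assume "1 + Re c = 0"
      then have "Re c = -1"
        by simp
      with c2 c(2) show False
        by (auto simp: complex_eq_iff)
    qed
    \<comment> \<open>For \<open>c = cis \<theta>\<close> this is minus the tangent of \<theta> / 2.
      The outer two shears are horizontal with factor \<open>t\<close>, the middle one is vertical
      with factor \<open>Im c\<close>.\<close>
    define t where "t = - Im c / (1 + Re c)"
    have t2: "t * (1 + Re c) = - Im c"
      using k by (simp add: t_def)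
    have "t * Im c * (1 + Re c) = - (Im c)\<^sup>2"
      using t2 by (metis mult.assoc mult.commute mult_minus_left power2_eq_square)
    also have "\<dots> = (Re c - 1) * (1 + Re c)"
      using c2 by (simp add: algebra_simps power2_eq_square)
    finally have t1: "t * Im c = Re c - 1"
      using k by simp
    have t: "1 + t * Im c = Re c" "t * Re c + t = - Im c"
      using t1 t2 by (simp_all add: algebra_simps)
    have "(\<lambda>z. c * z) = (\<lambda>z. (\<lambda>z. Complex (Re z + t * Im z) (Im z))
        ((\<lambda>z. (\<lambda>z. Complex (Re z) (Im z + Im c * Re z)) ((\<lambda>z. Complex (Re z + t * Im z) (Im z)) z)) z))"
    proof
      fix z
      have "Re z + t * Im z + t * (Im z + Im c * (Re z + t * Im z))
          = (1 + t * Im c) * Re z + (t * (1 + t * Im c) + t) * Im z"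
        by (simp add: algebra_simps)
      moreover have "Im z + Im c * (Re z + t * Im z) = (1 + t * Im c) * Im z + Im c * Re z"
        by (simp add: algebra_simps)
      ultimately show "c * z = (\<lambda>z. Complex (Re z + t * Im z) (Im z))
        ((\<lambda>z. (\<lambda>z. Complex (Re z) (Im z + Im c * Re z)) ((\<lambda>z. Complex (Re z + t * Im z) (Im z)) z)) z)"
        by (simp add: t complex_eq_iff)
    qed
    then show ?thesis
      using distr_lborel_comp[OF meas(1) _ distr_lborel_shear(1)
          distr_lborel_comp[OF meas(2) meas(1) distr_lborel_shear(2) distr_lborel_shear(1)]]
        measurable_compose[OF meas(1) meas(2)] by simp
  qed
  show ?thesis
  proof (cases "c = -1")
    case True
    \<comment> \<open>The rotation by pi, where the denominator of \<open>t\<close> vanishes, is the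
      square of multiplication by \<i>.\<close>
    have "distr lborel borel (\<lambda>z. \<i> * (\<i> * z)) = lborel"
      using rot[of \<i>] by (intro distr_lborel_comp[of "(*) \<i>" "(*) \<i>"]) (simp_all add: complex_eq_iff)
    then show ?thesis
      by (simp add: True mult.assoc[symmetric])
  qed (use rot assms in auto)
qed

lemma
  fixes f :: "complex \<Rightarrow> 'b::{banach, second_countable_topology}"
  assumes "cmod a = 1" and [measurable]: "f \<in> borel_measurable borel"
  shows integrable_lborel_rigid: "integrable lborel (\<lambda>z. f (a * z + b)) \<longleftrightarrow> integrable lborel f"
    and integral_lborel_rigid: "(LINT z|lborel. f (a * z + b)) = (LINT z|lborel. f z)"
proof -
  have "distr lborel borel (\<lambda>z. b + a * z) = lborel"
    using distr_lborel_rotation[OF assms(1)]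
    by (intro distr_lborel_comp[of "(+) b" "(*) a"] lborel_distr_plus) simp_all
  then have D: "distr lborel borel (\<lambda>z. a * z + b) = lborel"
    by (simp add: add.commute)
  show "integrable lborel (\<lambda>z. f (a * z + b)) \<longleftrightarrow> integrable lborel f"
    using integrable_distr_eq[of "\<lambda>z. a * z + b" lborel borel f] by (simp add: D)
  show "(LINT z|lborel. f (a * z + b)) = (LINT z|lborel. f z)"
    using integral_distr[of "\<lambda>z. a * z + b" lborel borel f] by (simp add: D)
qed

lemma
  fixes f :: "complex \<Rightarrow> 'b::{banach, second_countable_topology}"
  assumes [measurable]: "f \<in> borel_measurable borel"
  shows integrable_lborel_translate: "integrable lborel (\<lambda>z. f (z + b)) \<longleftrightarrow> integrable lborel f"
    and integral_lborel_translate: "(LINT z|lborel. f (z + b)) = (LINT z|lborel. f z)"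
  using integrable_lborel_rigid[of 1 f b] integral_lborel_rigid[of 1 f b] by auto

lemma gaussian_complex: "has_bochner_integral lborel (\<lambda>z. exp (- (cmod z)\<^sup>2)) pi"
proof -
  have *: "has_bochner_integral lborel (\<lambda>x::real. exp (- x\<^sup>2)) (sqrt pi)"
    using has_bochner_integral_even_function[OF gaussian_moment_0] by simp
  have g: "(\<integral>\<^sup>+x. ennreal (exp (- x\<^sup>2)) \<partial>lborel) = ennreal (sqrt pi)" for x :: real
    using * by (subst nn_integral_eq_integral) (auto simp: has_bochner_integral_iff)
  have "(\<integral>\<^sup>+z. ennreal (exp (- (cmod z)\<^sup>2)) \<partial>lborel)
      = (\<integral>\<^sup>+y. \<integral>\<^sup>+x. ennreal (exp (- y\<^sup>2)) * ennreal (exp (- x\<^sup>2)) \<partial>lborel \<partial>lborel)"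
    by (subst nn_integral_lborel_complex)
      (auto simp: cmod_power2 ennreal_mult[symmetric] exp_add[symmetric] intro!: nn_integral_cong)
  also have "\<dots> = ennreal (sqrt pi) * ennreal (sqrt pi)"
    by (simp add: nn_integral_cmult nn_integral_multc g)
  also have "\<dots> = ennreal pi"
    by (subst ennreal_mult[symmetric]) auto
  finally show ?thesis
    by (intro has_bochner_integral_nn_integral) auto
qed

subsection \<open>Averages over circles\<close>

text \<open>A density keeps the whole real line as space and the Borel sets as sigma-algebra, so
  integrands need no restriction; total mass 1 turns integrals over the circle parameter into
  averages.\<close>

definition unit_interval_measure :: "real measure" where
  "unit_interval_measure = density lborel (\<lambda>t. ennreal (indicator {0..1} t))"

lemma sets_unit_interval_measure [simp, measurable_cong]: "sets unit_interval_measure = sets borel"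
  by (simp add: unit_interval_measure_def)

lemma space_unit_interval_measure [simp]: "space unit_interval_measure = UNIV"
  by (simp add: unit_interval_measure_def)

interpretation unit_interval: prob_space unit_interval_measure
  by standard (simp add: unit_interval_measure_def emeasure_density ennreal_indicator)

lemma measure_unit_interval_UNIV [simp]: "measure unit_interval_measure UNIV = 1"
  using unit_interval.prob_space by simp

interpretation unit_interval_lborel: pair_sigma_finite unit_interval_measure lborel ..

lemma integral_unit_interval:
  fixes f :: "real \<Rightarrow> 'b::{banach, second_countable_topology}"
  assumes "f \<in> borel_measurable borel"
  shows "(LINT t|unit_interval_measure. f t) = (LINT t|lborel. indicator {0..1} t *\<^sub>R f t)"
  unfolding unit_interval_measure_def using assms by (subst integral_density) auto

abbreviation circ :: "real \<Rightarrow> complex" where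
  "circ t \<equiv> cis (2 * pi * t)"

lemma measurable_cnj [measurable]: "cnj \<in> borel_measurable borel"
  by (intro borel_measurable_continuous_onI continuous_intros)

lemma measurable_cis [measurable]: "cis \<in> borel_measurable borel"
  by (intro borel_measurable_continuous_onI continuous_intros)

text \<open>Orthogonality of the characters of the circle: off the diagonal the integrand is
  \<open>cis (k * t)\<close> with \<open>k\<close> a nonzero multiple of 2 pi, and its primitive
  takes equal values at 0 and 1.\<close>

lemma integral_circ_power:
  "(LINT t|unit_interval_measure. circ t ^ n * cnj (circ t) ^ m) = (if n = m then 1 else 0)"
proof (cases "n = m")
  case True
  then show ?thesis
    by (simp add: power_mult_distrib[symmetric] complex_mult_cnj cis_mult cis_cnj)
next
  case False
  define k where "k = (2 * pi * (real n - real m))"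
  have k: "k \<noteq> 0"
    using False by (simp add: k_def)
  have eq: "circ t ^ n * cnj (circ t) ^ m = cis (k * t)" for t
    by (simp add: cis_cnj Complex.DeMoivre cis_mult k_def algebra_simps)
  have "((\<lambda>t. exp (\<i> * k * complex_of_real t) / (\<i> * k)) has_vector_derivative cis (k * t)) (at t within {0..1})" for t
    unfolding cis_conv_exp has_real_derivative_iff_has_vector_derivative[symmetric]
    using k by (auto intro!: derivative_eq_intros has_vector_derivative_real_field simp: mult_ac)
  then have "(LINT t|lborel. indicator {0..1} t *\<^sub>R cis (k * t))
      = exp (\<i> * k * complex_of_real 1) / (\<i> * k) - exp (\<i> * k * complex_of_real 0) / (\<i> * k)"
    by (intro integral_FTC_atLeastAtMost continuous_intros) auto
  also have "exp (\<i> * k * complex_of_real 1) = cis (2 * pi * (real n - real m))"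
    by (simp add: k_def cis_conv_exp mult_ac)
  also have "\<dots> = 1"
    using eq[of 1] by (simp add: k_def cis_cnj)
  finally show ?thesis
    using False by (simp add: eq integral_unit_interval)
qed

text \<open>On a probability space the constants \<open>c m\<close> bound the integrals of the
  norms, so the majorant of the Weierstrass test also justifies exchanging series and
  average.\<close>

lemma sums_integral_unit_interval:
  fixes h :: "nat \<Rightarrow> real \<Rightarrow> complex"
  assumes [measurable]: "\<And>m. h m \<in> borel_measurable borel"
    and h: "\<And>m t. cmod (h m t) \<le> c m" and c: "summable c"
    and S: "\<And>t. (\<lambda>m. h m t) sums S t"
  shows "(\<lambda>m. LINT t|unit_interval_measure. h m t) sums (LINT t|unit_interval_measure. S t)"
proof -
  have int: "integrable unit_interval_measure (h m)" for m
    by (rule unit_interval.integrable_const_bound[of _ "c m"]) (auto simp: h)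
  have "(\<lambda>m. LINT t|unit_interval_measure. h m t) sums (LINT t|unit_interval_measure. (\<Sum>m. h m t))"
  proof (rule sums_integral[OF int])
    show "AE t in unit_interval_measure. summable (\<lambda>m. cmod (h m t))"
      by (intro AE_I2 summable_comparison_test'[OF c]) (simp add: h)
    have "(LINT t|unit_interval_measure. cmod (h m t)) \<le> c m" for m
      using integral_mono[of unit_interval_measure "\<lambda>t. cmod (h m t)" "\<lambda>_. c m"] int h
      by simp
    then show "summable (\<lambda>m. LINT t|unit_interval_measure. cmod (h m t))"
      by (intro summable_comparison_test'[OF c]) simp
  qed
  moreover have "(\<Sum>m. h m t) = S t" for t
    using S sums_unique by metis
  ultimately show ?thesis
    by simp
qed

lemma entire_power_series_summable_norm:
  fixes a :: "nat \<Rightarrow> complex"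
  assumes "\<And>z. (\<lambda>n. a n * z ^ n) sums f z"
  shows "summable (\<lambda>n. cmod (a n) * r ^ n)"
proof -
  have "summable (\<lambda>n. norm (a n * (of_real r) ^ n))"
    \<comment> \<open>Convergence at the strictly larger radius gives absolute convergence at
      \<open>r\<close>.\<close>
    by (rule powser_insidea[of a "of_real (\<bar>r\<bar> + 1)"]) (use assms in \<open>auto simp: sums_iff\<close>)
  then have "summable (\<lambda>n. norm (cmod (a n) * r ^ n))"
    by (simp add: norm_mult norm_power abs_mult power_abs)
  then show ?thesis
    by (rule summable_norm_cancel)
qed

text \<open>The double series is avoided by expanding one factor at a time: first \<open>g\<close>
  against a monomial, where orthogonality leaves a single term (\<open>coeff\<close>), then
  \<open>f\<close> with \<open>g\<close> kept whole and bounded by \<open>M\<close> on the closed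
  disc.\<close>

lemma circle_parseval:
  assumes a: "\<And>z. (\<lambda>n. a n * z ^ n) sums f z" and b: "\<And>z. (\<lambda>n. b n * z ^ n) sums g z"
    and f: "continuous_on UNIV f" and g: "continuous_on UNIV g"
  shows "(\<lambda>n. a n * cnj (b n) * of_real (cmod z ^ (2 * n))) sums
    (LINT t|unit_interval_measure. f (circ t * z) * cnj (g (circ t * z)))"
proof -
  have [measurable]: "f \<in> borel_measurable borel" "g \<in> borel_measurable borel"
    using f g by (auto intro: borel_measurable_continuous_onI)
  have mono: "(LINT t|unit_interval_measure. (circ t * z) ^ n * cnj (circ t * z) ^ m)
      = (if n = m then of_real (cmod z ^ (2 * n)) else 0)" for n m
  proof -
    have "(LINT t|unit_interval_measure. (circ t * z) ^ n * cnj (circ t * z) ^ m)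
        = (LINT t|unit_interval_measure. z ^ n * cnj z ^ m * (circ t ^ n * cnj (circ t) ^ m))"
      by (simp add: power_mult_distrib mult_ac)
    also have "\<dots> = z ^ n * cnj z ^ m * (if n = m then 1 else 0)"
      by (simp only: integral_mult_right_zero integral_circ_power)
    also have "\<dots> = (if n = m then of_real (cmod z ^ (2 * n)) else 0)"
      by (simp add: power_mult complex_norm_square[unfolded of_real_power] power_mult_distrib)
    finally show ?thesis .
  qed
  have coeff: "(LINT t|unit_interval_measure. (circ t * z) ^ n * cnj (g (circ t * z)))
      = cnj (b n) * of_real (cmod z ^ (2 * n))" for n
  proof -
    have "(\<lambda>m. LINT t|unit_interval_measure. (circ t * z) ^ n * cnj (b m * (circ t * z) ^ m))
        sums (LINT t|unit_interval_measure. (circ t * z) ^ n * cnj (g (circ t * z)))"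
    proof (rule sums_integral_unit_interval)
      show "cmod ((circ t * z) ^ n * cnj (b m * (circ t * z) ^ m)) \<le> cmod z ^ n * (cmod (b m) * cmod z ^ m)" for m t
        by (simp add: norm_mult norm_power)
      show "summable (\<lambda>m. cmod z ^ n * (cmod (b m) * cmod z ^ m))"
        by (intro summable_mult entire_power_series_summable_norm[OF b])
      show "(\<lambda>m. (circ t * z) ^ n * cnj (b m * (circ t * z) ^ m)) sums ((circ t * z) ^ n * cnj (g (circ t * z)))" for t
        using b by (intro sums_mult) (simp only: sums_cnj)
    qed measurable
    moreover have "(\<lambda>m. LINT t|unit_interval_measure. (circ t * z) ^ n * cnj (b m * (circ t * z) ^ m))
        = (\<lambda>m. if m = n then cnj (b m) * of_real (cmod z ^ (2 * m)) else 0)"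
    proof
      fix m
      have "(LINT t|unit_interval_measure. (circ t * z) ^ n * cnj (b m * (circ t * z) ^ m))
          = (LINT t|unit_interval_measure. cnj (b m) * ((circ t * z) ^ n * cnj (circ t * z) ^ m))"
        by (simp add: mult_ac)
      also have "\<dots> = cnj (b m) * (if n = m then of_real (cmod z ^ (2 * n)) else 0)"
        by (simp only: integral_mult_right_zero mono)
      finally show "(LINT t|unit_interval_measure. (circ t * z) ^ n * cnj (b m * (circ t * z) ^ m))
          = (if m = n then cnj (b m) * of_real (cmod z ^ (2 * m)) else 0)"
        by auto
    qed
    moreover have "(\<lambda>m. if m = n then cnj (b m) * of_real (cmod z ^ (2 * m)) else 0)
        sums (cnj (b n) * of_real (cmod z ^ (2 * n)))"
      by (rule sums_single)
    ultimately show ?thesis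
      by (simp only: sums_unique2)
  qed
  obtain M where M: "\<And>w. cmod w \<le> cmod z \<Longrightarrow> cmod (g w) \<le> M"
  proof -
    have "compact (g ` cball 0 (cmod z))"
      by (intro compact_continuous_image continuous_on_subset[OF g]) auto
    then show ?thesis
      using that by (force dest!: compact_imp_bounded simp: bounded_iff)
  qed
  have "(\<lambda>n. LINT t|unit_interval_measure. a n * ((circ t * z) ^ n * cnj (g (circ t * z))))
      sums (LINT t|unit_interval_measure. f (circ t * z) * cnj (g (circ t * z)))"
  proof (rule sums_integral_unit_interval)
    show "cmod (a m * ((circ t * z) ^ m * cnj (g (circ t * z)))) \<le> (cmod (a m) * cmod z ^ m) * M" for m t
      using M[of "circ t * z"] by (simp add: norm_mult norm_power mult_left_mono mult.assoc)
    show "summable (\<lambda>m. (cmod (a m) * cmod z ^ m) * M)"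
      by (intro summable_mult2 entire_power_series_summable_norm[OF a])
    show "(\<lambda>m. a m * ((circ t * z) ^ m * cnj (g (circ t * z)))) sums (f (circ t * z) * cnj (g (circ t * z)))" for t
      unfolding mult.assoc[symmetric] by (intro sums_mult2 a)
  qed measurable
  then show ?thesis
    unfolding integral_mult_right_zero coeff by (simp only: mult.assoc)
qed

text \<open>Each rotated copy of \<open>F\<close> has the same integral and the same norm integral,
  so the latter is constant in \<open>t\<close> and Fubini applies on the product with the parameter
  interval.\<close>

lemma
  fixes F :: "complex \<Rightarrow> 'b::{banach, second_countable_topology}"
  assumes [measurable]: "F \<in> borel_measurable borel" and F: "integrable lborel F"
  shows integrable_circle_average:
      "integrable lborel (\<lambda>z. LINT t|unit_interval_measure. F (circ t * z))"
    and integral_circle_average: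
      "(LINT z|lborel. LINT t|unit_interval_measure. F (circ t * z)) = (LINT z|lborel. F z)"
proof -
  have int: "integrable lborel (\<lambda>z. F (circ t * z))"
       and eq: "(LINT z|lborel. F (circ t * z)) = (LINT z|lborel. F z)"
       and eqn: "(LINT z|lborel. norm (F (circ t * z))) = (LINT z|lborel. norm (F z))" for t
    using integrable_lborel_rigid[of "circ t" F 0] integral_lborel_rigid[of "circ t" F 0]
      integral_lborel_rigid[of "circ t" "\<lambda>z. norm (F z)" 0] F by auto
  have "integrable (unit_interval_measure \<Otimes>\<^sub>M lborel) (\<lambda>(t, z). F (circ t * z))"
    by (rule unit_interval_lborel.Fubini_integrable) (auto simp: eqn int)
  from unit_interval_lborel.integrable_snd[OF this] unit_interval_lborel.Fubini_integral[OF this]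
  show "integrable lborel (\<lambda>z. LINT t|unit_interval_measure. F (circ t * z))"
    "(LINT z|lborel. LINT t|unit_interval_measure. F (circ t * z)) = (LINT z|lborel. F z)"
    by (auto simp: eq)
qed

subsection \<open>The Fock space and its reproducing kernel\<close>

lemma holomorphic_borel_measurable: "f holomorphic_on UNIV \<Longrightarrow> f \<in> borel_measurable borel"
  by (simp add: borel_measurable_continuous_onI holomorphic_on_imp_continuous_on)

lemma fock_spaceI:
  assumes "f holomorphic_on UNIV" "integrable lborel (\<lambda>z. (cmod (f z))\<^sup>2 * exp (- (cmod z)\<^sup>2))"
  shows "f \<in> fock_space"
  using assms by (simp add: fock_space_def)

lemma fock_space_holomorphic: "f \<in> fock_space \<Longrightarrow> f holomorphic_on UNIV"
  by (simp add: fock_space_def)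

lemma fock_space_measurable: "f \<in> fock_space \<Longrightarrow> f \<in> borel_measurable borel"
  by (simp add: holomorphic_borel_measurable fock_space_holomorphic)

lemma fock_space_integrable:
  "f \<in> fock_space \<Longrightarrow> integrable lborel (\<lambda>z. (cmod (f z))\<^sup>2 * exp (- (cmod z)\<^sup>2))"
  by (simp add: fock_space_def)

lemma fock_inner_integrable:
  assumes "f \<in> fock_space" "g \<in> fock_space"
  shows "integrable lborel (\<lambda>z. f z * cnj (g z) * of_real (exp (- (cmod z)\<^sup>2)))"
proof (rule Bochner_Integration.integrable_bound)
  note [measurable] = assms[THEN fock_space_measurable]
  show "integrable lborel (\<lambda>z. (cmod (f z))\<^sup>2 * exp (- (cmod z)\<^sup>2) + (cmod (g z))\<^sup>2 * exp (- (cmod z)\<^sup>2))"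
    using assms by (intro Bochner_Integration.integrable_add fock_space_integrable)
  show "(\<lambda>z. f z * cnj (g z) * of_real (exp (- (cmod z)\<^sup>2))) \<in> borel_measurable lborel"
    by measurable
  have "cmod (f z) * cmod (g z) \<le> (cmod (f z))\<^sup>2 + (cmod (g z))\<^sup>2" for z
    using sum_squares_bound[of "cmod (f z)" "cmod (g z)"] zero_le_power2[of "cmod (f z)"]
      zero_le_power2[of "cmod (g z)"] mult_nonneg_nonneg[OF norm_ge_zero[of "f z"] norm_ge_zero[of "g z"]]
    by linarith
  then show "AE z in lborel. norm (f z * cnj (g z) * of_real (exp (- (cmod z)\<^sup>2)))
      \<le> norm ((cmod (f z))\<^sup>2 * exp (- (cmod z)\<^sup>2) + (cmod (g z))\<^sup>2 * exp (- (cmod z)\<^sup>2))"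
    by (simp add: norm_mult flip: distrib_right)
qed

lemma fock_space_diff:
  assumes "f \<in> fock_space" "g \<in> fock_space"
  shows "(\<lambda>z. f z - g z) \<in> fock_space"
proof (rule fock_spaceI)
  show "(\<lambda>z. f z - g z) holomorphic_on UNIV"
    using assms by (intro holomorphic_intros fock_space_holomorphic)
  note [measurable] = assms[THEN fock_space_measurable]
  show "integrable lborel (\<lambda>z. (cmod (f z - g z))\<^sup>2 * exp (- (cmod z)\<^sup>2))"
  proof (rule Bochner_Integration.integrable_bound)
    show "integrable lborel (\<lambda>z. 2 * ((cmod (f z))\<^sup>2 * exp (- (cmod z)\<^sup>2)) + 2 * ((cmod (g z))\<^sup>2 * exp (- (cmod z)\<^sup>2)))"
      using assms by (intro Bochner_Integration.integrable_add integrable_mult_right fock_space_integrable)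
    have "(cmod (f z - g z))\<^sup>2 \<le> 2 * (cmod (f z))\<^sup>2 + 2 * (cmod (g z))\<^sup>2" for z
      using power_mono[OF norm_triangle_ineq4[of "f z" "g z"], of 2] sum_squares_bound[of "cmod (f z)" "cmod (g z)"]
      by (simp add: power2_sum)
    then have "(cmod (f z - g z))\<^sup>2 * exp (- (cmod z)\<^sup>2)
        \<le> (2 * (cmod (f z))\<^sup>2 + 2 * (cmod (g z))\<^sup>2) * exp (- (cmod z)\<^sup>2)" for z
      by (intro mult_right_mono) auto
    then show "AE z in lborel. norm ((cmod (f z - g z))\<^sup>2 * exp (- (cmod z)\<^sup>2))
       \<le> norm (2 * ((cmod (f z))\<^sup>2 * exp (- (cmod z)\<^sup>2)) + 2 * ((cmod (g z))\<^sup>2 * exp (- (cmod z)\<^sup>2)))"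
      by (auto simp: distrib_right mult.assoc)
  qed measurable
qed

lemma fock_space_cmult:
  assumes "f \<in> fock_space"
  shows "(\<lambda>z. c * f z) \<in> fock_space"
proof (rule fock_spaceI)
  show "(\<lambda>z. c * f z) holomorphic_on UNIV"
    using assms by (intro holomorphic_intros fock_space_holomorphic)
  show "integrable lborel (\<lambda>z. (cmod (c * f z))\<^sup>2 * exp (- (cmod z)\<^sup>2))"
    using integrable_mult_right[OF fock_space_integrable[OF assms], of "(cmod c)\<^sup>2"]
    by (simp only: norm_mult power_mult_distrib mult.assoc)
qed

lemma fock_inner_diff_left:
  assumes "f \<in> fock_space" "g \<in> fock_space" "h \<in> fock_space"
  shows "fock_inner (\<lambda>z. f z - g z) h = fock_inner f h - fock_inner g h"
  unfolding fock_inner_def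
  by (simp add: left_diff_distrib diff_divide_distrib fock_inner_integrable assms)

lemma fock_inner_cmult_left: "fock_inner (\<lambda>z. c * f z) h = c * fock_inner f h"
  unfolding fock_inner_def by (simp add: mult.assoc)

lemma fock_inner_commute: "fock_inner g f = cnj (fock_inner f g)"
proof -
  have "g z * cnj (f z) * of_real (exp (- (cmod z)\<^sup>2)) = cnj (f z * cnj (g z) * of_real (exp (- (cmod z)\<^sup>2)))" for z
    by simp
  then show ?thesis
    unfolding fock_inner_def complex_cnj_divide by (simp only: Bochner_Integration.integral_cnj complex_cnj_complex_of_real)
qed

lemma fock_inner_diff_right:
  assumes "f \<in> fock_space" "g \<in> fock_space" "h \<in> fock_space"
  shows "fock_inner h (\<lambda>z. f z - g z) = fock_inner h f - fock_inner h g"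
  unfolding fock_inner_commute[of h "\<lambda>z. f z - g z"] fock_inner_commute[of h f] fock_inner_commute[of h g]
  by (simp add: fock_inner_diff_left assms)

lemma fock_inner_cmult_right: "fock_inner f (\<lambda>z. c * h z) = cnj c * fock_inner f h"
  unfolding fock_inner_commute[of f "\<lambda>z. c * h z"] fock_inner_commute[of f h]
  by (simp add: fock_inner_cmult_left)

lemma fock_inner_self:
  "fock_inner f f = of_real ((LINT z|lborel. (cmod (f z))\<^sup>2 * exp (- (cmod z)\<^sup>2)) / pi)"
proof -
  have "f z * cnj (f z) * of_real (exp (- (cmod z)\<^sup>2)) = of_real ((cmod (f z))\<^sup>2 * exp (- (cmod z)\<^sup>2))" for z
    by (simp add: complex_norm_square[unfolded of_real_power])
  then show ?thesis
    unfolding fock_inner_def by (simp only: integral_complex_of_real of_real_divide)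
qed

lemma fock_norm_eq: "fock_norm f = sqrt ((LINT z|lborel. (cmod (f z))\<^sup>2 * exp (- (cmod z)\<^sup>2)) / pi)"
  by (simp add: fock_norm_def fock_inner_self del: of_real_divide)

lemma fock_norm_nonneg [simp]: "0 \<le> fock_norm f"
  by (simp add: fock_norm_eq)

lemma fock_norm_power2: "(fock_norm f)\<^sup>2 = (LINT z|lborel. (cmod (f z))\<^sup>2 * exp (- (cmod z)\<^sup>2)) / pi"
  by (simp add: fock_norm_eq)

lemma fock_inner_self': "fock_inner f f = of_real ((fock_norm f)\<^sup>2)"
  by (simp only: fock_norm_power2 fock_inner_self)

lemma fock_norm_cmult: "fock_norm (\<lambda>z. c * f z) = cmod c * fock_norm f"
proof -
  have "fock_norm (\<lambda>z. c * f z)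
      = sqrt ((LINT z|lborel. (cmod c)\<^sup>2 * ((cmod (f z))\<^sup>2 * exp (- (cmod z)\<^sup>2))) / pi)"
    by (simp only: fock_norm_eq norm_mult power_mult_distrib mult.assoc)
  also have "\<dots> = sqrt ((cmod c)\<^sup>2 * ((LINT z|lborel. (cmod (f z))\<^sup>2 * exp (- (cmod z)\<^sup>2)) / pi))"
    by (simp only: integral_mult_right_zero times_divide_eq_right)
  finally show ?thesis
    by (simp only: real_sqrt_mult real_sqrt_abs abs_norm_cancel fock_norm_eq[of f])
qed

text \<open>Integrating \<open>2 * x * y \<le> l * x\<^sup>2 + y\<^sup>2 / l\<close> gives a bound
  for every positive \<open>l\<close>, and the quotient of the two norms is the optimal
  choice.\<close>

lemma fock_cauchy_schwarz:
  assumes "f \<in> fock_space" "g \<in> fock_space"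
  shows "cmod (fock_inner f g) \<le> fock_norm f * fock_norm g"
proof -
  define F where "F f z = (cmod (f z))\<^sup>2 * exp (- (cmod z)\<^sup>2)" for f and z :: complex
  have *: "2 * cmod (fock_inner f g) \<le> l * (fock_norm f)\<^sup>2 + (fock_norm g)\<^sup>2 / l" if l: "l > 0" for l
  proof -
    have "cmod (fock_inner f g) = cmod (LINT z|lborel. f z * cnj (g z) * of_real (exp (- (cmod z)\<^sup>2))) / pi"
      by (simp add: fock_inner_def norm_divide)
    also have "\<dots> \<le> (LINT z|lborel. cmod (f z * cnj (g z) * of_real (exp (- (cmod z)\<^sup>2)))) / pi"
      by (intro divide_right_mono integral_norm_bound) auto
    also have "\<dots> \<le> (LINT z|lborel. l / 2 * F f z + 1 / (2 * l) * F g z) / pi"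
    proof (intro divide_right_mono integral_mono)
      show "integrable lborel (\<lambda>z. cmod (f z * cnj (g z) * of_real (exp (- (cmod z)\<^sup>2))))"
        using assms by (intro integrable_norm fock_inner_integrable)
      show "integrable lborel (\<lambda>z. l / 2 * F f z + 1 / (2 * l) * F g z)"
        unfolding F_def using assms
        by (intro Bochner_Integration.integrable_add integrable_mult_right fock_space_integrable)
      fix z
      have "2 * l * (cmod (f z) * cmod (g z)) \<le> (l * cmod (f z))\<^sup>2 + (cmod (g z))\<^sup>2"
        using sum_squares_bound[of "l * cmod (f z)" "cmod (g z)"] by (simp add: mult_ac)
      then have "cmod (f z) * cmod (g z) \<le> l / 2 * (cmod (f z))\<^sup>2 + 1 / (2 * l) * (cmod (g z))\<^sup>2"
        using l by (simp add: field_simps power2_eq_square)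
      then have "cmod (f z) * cmod (g z) * exp (- (cmod z)\<^sup>2)
          \<le> (l / 2 * (cmod (f z))\<^sup>2 + 1 / (2 * l) * (cmod (g z))\<^sup>2) * exp (- (cmod z)\<^sup>2)"
        by (intro mult_right_mono) auto
      then show "cmod (f z * cnj (g z) * of_real (exp (- (cmod z)\<^sup>2))) \<le> l / 2 * F f z + 1 / (2 * l) * F g z"
        by (simp add: norm_mult F_def distrib_right)
    qed auto
    also have "\<dots> = l / 2 * (fock_norm f)\<^sup>2 + 1 / (2 * l) * (fock_norm g)\<^sup>2"
      using assms[THEN fock_space_integrable]
      by (simp add: fock_norm_power2 F_def add_divide_distrib)
    finally show ?thesis
      using l by (simp add: field_simps)
  qed
  show ?thesis
  proof (cases "fock_norm f = 0 \<or> fock_norm g = 0")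
    case False
    then have "fock_norm f > 0" "fock_norm g > 0"
      by (simp_all add: order_less_le)
    then show ?thesis
      using *[of "fock_norm g / fock_norm f"] by (simp add: power2_eq_square)
  next
    case True
    have "fock_inner f g = 0"
    proof (rule ccontr)
      assume "fock_inner f g \<noteq> 0"
      \<comment> \<open>If one norm vanishes there is no optimal \<open>l\<close>; a sufficiently
        large or small \<open>l\<close> makes the surviving term at most \<open>x\<close>, against
        the lower bound \<open>2 * x\<close>.\<close>
      define x where "x = cmod (fock_inner f g)"
      have x: "x > 0"
        using \<open>fock_inner f g \<noteq> 0\<close> by (simp add: x_def)
      from True show False
      proof
        assume "fock_norm f = 0"
        then have "2 * x \<le> (fock_norm g)\<^sup>2 / (((fock_norm g)\<^sup>2 + 1) / x)"
          using *[of "((fock_norm g)\<^sup>2 + 1) / x"] x by (simp add: x_def add_nonneg_pos)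
        also have "\<dots> = x * ((fock_norm g)\<^sup>2 / ((fock_norm g)\<^sup>2 + 1))"
          by simp
        also have "\<dots> \<le> x * 1"
          using x by (intro mult_left_mono) (auto simp: add_nonneg_pos)
        finally show False
          using x by simp
      next
        assume "fock_norm g = 0"
        then have "2 * x \<le> (x / ((fock_norm f)\<^sup>2 + 1)) * (fock_norm f)\<^sup>2"
          using *[of "x / ((fock_norm f)\<^sup>2 + 1)"] x by (simp add: x_def add_nonneg_pos)
        also have "\<dots> = x * ((fock_norm f)\<^sup>2 / ((fock_norm f)\<^sup>2 + 1))"
          by simp
        also have "\<dots> \<le> x * 1"
          using x by (intro mult_left_mono) (auto simp: add_nonneg_pos)
        finally show False
          using x by simp
      qed
    qed
    then show ?thesis
      by simp
  qed
qed

section \<open>Kernel functions, the reproducing formula and bounded point evaluations\<close>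

definition fock_kernel :: "complex \<Rightarrow> complex \<Rightarrow> complex" where
  "fock_kernel w z = exp (z * cnj w)"

lemma norm_fock_kernel: "cmod (fock_kernel w z) = exp (Re (z * cnj w))"
  by (simp add: fock_kernel_def)

lemma cmod_diff_power2: "(cmod (z - w))\<^sup>2 = (cmod z)\<^sup>2 - 2 * Re (z * cnj w) + (cmod w)\<^sup>2"
  unfolding cmod_power2 by (simp add: algebra_simps power2_eq_square)

text \<open>Completing the square exhibits the integrand as \<open>exp ((cmod w)\<^sup>2)\<close>
  times a Gaussian centred at \<open>w\<close>.\<close>

lemma integrable_shifted_gaussian: "integrable lborel (\<lambda>z. exp (2 * Re (z * cnj w)) * exp (- (cmod z)\<^sup>2))"
proof -
  have "integrable lborel (\<lambda>z. exp (- (cmod z)\<^sup>2))"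
    using gaussian_complex by (simp add: has_bochner_integral_iff)
  then have "integrable lborel (\<lambda>z. exp (- (cmod (z + - w))\<^sup>2))"
    by (subst integrable_lborel_translate) auto
  then have "integrable lborel (\<lambda>z. exp ((cmod w)\<^sup>2) * exp (- (cmod (z + - w))\<^sup>2))"
    by simp
  also have "(\<lambda>z. exp ((cmod w)\<^sup>2) * exp (- (cmod (z + - w))\<^sup>2))
      = (\<lambda>z. exp (2 * Re (z * cnj w)) * exp (- (cmod z)\<^sup>2))"
    using cmod_diff_power2[of _ w] by (auto simp: exp_add[symmetric])
  finally show ?thesis .
qed

text \<open>With \<open>cmod z \<le> \<bar>Re z\<bar> + \<bar>Im z\<bar>\<close> and
  \<open>exp \<bar>x\<bar> \<le> exp x + exp (- x)\<close> the weighted square is dominated by four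
  shifted Gaussians centred at the corners of a square of half-side \<open>K\<close>. This criterion
  supplies kernels and polynomials as members of the space.\<close>

lemma fock_space_exponential_type:
  assumes "f holomorphic_on UNIV" and f: "\<And>z. cmod (f z) \<le> M * exp (k * cmod z)"
  shows "f \<in> fock_space"
proof (rule fock_spaceI)
  note [measurable] = holomorphic_borel_measurable[OF assms(1)]
  define K where "K = \<bar>k\<bar>"
  define G where "G w z = exp (2 * Re (z * cnj w)) * exp (- (cmod z)\<^sup>2)" for w z
  show "integrable lborel (\<lambda>z. (cmod (f z))\<^sup>2 * exp (- (cmod z)\<^sup>2))"
  proof (rule Bochner_Integration.integrable_bound)
    show "integrable lborel (\<lambda>z. M\<^sup>2 * (G (Complex K K) z + G (Complex K (-K)) z
        + G (Complex (-K) K) z + G (Complex (-K) (-K)) z))"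
      unfolding G_def
      by (intro integrable_mult_right Bochner_Integration.integrable_add integrable_shifted_gaussian)
    have "(cmod (f z))\<^sup>2 * exp (- (cmod z)\<^sup>2) \<le> M\<^sup>2 * (G (Complex K K) z + G (Complex K (-K)) z
        + G (Complex (-K) K) z + G (Complex (-K) (-K)) z)" for z
    proof -
      have "cmod (f z) \<le> M * exp (K * cmod z)"
      proof -
        have "0 \<le> M * exp (k * cmod z)"
          using f[of z] norm_ge_zero order_trans by blast
        then have "0 \<le> M"
          by (simp add: zero_le_mult_iff)
        then show ?thesis
          using f[of z] by (elim order_trans) (auto simp: K_def intro!: mult_left_mono mult_right_mono)
      qed
      then have "(cmod (f z))\<^sup>2 \<le> (M * exp (K * cmod z))\<^sup>2"
        by (intro power_mono) auto
      also have "\<dots> = M\<^sup>2 * exp (2 * K * cmod z)"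
        by (simp add: power_mult_distrib power2_eq_square mult_exp_exp)
      also have "\<dots> \<le> M\<^sup>2 * (exp (2 * K * \<bar>Re z\<bar>) * exp (2 * K * \<bar>Im z\<bar>))"
      proof (intro mult_left_mono)
        have "2 * K * cmod z \<le> 2 * K * (\<bar>Re z\<bar> + \<bar>Im z\<bar>)"
          by (intro mult_left_mono cmod_le) (auto simp: K_def)
        then show "exp (2 * K * cmod z) \<le> exp (2 * K * \<bar>Re z\<bar>) * exp (2 * K * \<bar>Im z\<bar>)"
          by (simp add: mult_exp_exp distrib_left)
      qed auto
      also have "\<dots> \<le> M\<^sup>2 * ((exp (2 * K * Re z) + exp (- (2 * K * Re z)))
          * (exp (2 * K * Im z) + exp (- (2 * K * Im z))))"
        by (intro mult_left_mono mult_mono) (auto simp: abs_if add_nonneg_nonneg)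
      also have "\<dots> = M\<^sup>2 * (exp (2 * Re (z * cnj (Complex K K))) + exp (2 * Re (z * cnj (Complex K (-K))))
          + exp (2 * Re (z * cnj (Complex (-K) K))) + exp (2 * Re (z * cnj (Complex (-K) (-K)))))"
        by (simp add: algebra_simps exp_add exp_diff exp_minus divide_inverse)
      finally have "(cmod (f z))\<^sup>2 * exp (- (cmod z)\<^sup>2) \<le> M\<^sup>2 * (exp (2 * Re (z * cnj (Complex K K)))
          + exp (2 * Re (z * cnj (Complex K (-K)))) + exp (2 * Re (z * cnj (Complex (-K) K)))
          + exp (2 * Re (z * cnj (Complex (-K) (-K))))) * exp (- (cmod z)\<^sup>2)"
        by (intro mult_right_mono) auto
      then show ?thesis
        by (simp only: G_def distrib_right distrib_left mult.assoc)
    qed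
    then show "AE z in lborel. norm ((cmod (f z))\<^sup>2 * exp (- (cmod z)\<^sup>2)) \<le> norm (M\<^sup>2 * (G (Complex K K) z
        + G (Complex K (-K)) z + G (Complex (-K) K) z + G (Complex (-K) (-K)) z))"
      by (auto intro!: AE_I2 order_trans[OF _ abs_ge_self])
  qed measurable
qed (fact assms(1))

lemma fock_kernel_in_fock_space [simp]: "fock_kernel w \<in> fock_space"
proof (rule fock_space_exponential_type)
  show "fock_kernel w holomorphic_on UNIV"
    unfolding fock_kernel_def by (intro holomorphic_intros)
  show "cmod (fock_kernel w z) \<le> 1 * exp (cmod w * cmod z)" for z
    using complex_Re_le_cmod[of "z * cnj w"] by (simp add: norm_fock_kernel norm_mult mult.commute)
qed

lemma entire_power_series:
  assumes "f holomorphic_on UNIV"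
  shows "(\<lambda>n. (deriv ^^ n) f 0 / fact n * z ^ n) sums f z"
  using holomorphic_power_series[of f 0 "cmod z + 1" z] holomorphic_on_subset[OF assms] by auto

text \<open>This is \<open>circle_parseval\<close> against the constant function 1, whose only
  nonzero coefficient is the zeroth.\<close>

lemma circle_mean_value:
  assumes "f holomorphic_on UNIV"
  shows "(LINT t|unit_interval_measure. f (circ t * z)) = f 0"
proof -
  have one: "(\<lambda>n. (if n = 0 then 1 else 0) * w ^ n) sums 1" for w :: complex
    using sums_single[of 0 "\<lambda>n. w ^ n"] by (simp add: if_distrib if_distribR cong: if_cong)
  have "(\<lambda>n. (deriv ^^ n) f 0 / fact n * cnj (if n = 0 then 1 else 0) * of_real (cmod z ^ (2 * n)))
      sums (LINT t|unit_interval_measure. f (circ t * z) * cnj 1)"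
    by (rule circle_parseval[OF entire_power_series[OF assms] one])
      (auto intro: holomorphic_on_imp_continuous_on assms)
  moreover have "(\<lambda>n. (deriv ^^ n) f 0 / fact n * cnj (if n = 0 then 1 else 0) * of_real (cmod z ^ (2 * n)))
      = (\<lambda>n. if n = 0 then f 0 else 0)"
    by auto
  ultimately have "(\<lambda>n. if n = 0 then f 0 else 0) sums (LINT t|unit_interval_measure. f (circ t * z))"
    by simp
  then show ?thesis
    using sums_single[of 0 "\<lambda>_. f 0"] by (simp add: sums_unique2)
qed

text \<open>The weight is radial, so averaging over circles replaces \<open>f\<close> by its mean
  value \<open>f 0\<close> and leaves the total Gaussian mass pi.\<close>

lemma gaussian_mean_value:
  fixes f :: "complex \<Rightarrow> complex"
  assumes "f holomorphic_on UNIV" and "integrable lborel (\<lambda>z. f z * of_real (exp (- (cmod z)\<^sup>2)))"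
  shows "(LINT z|lborel. f z * of_real (exp (- (cmod z)\<^sup>2))) = pi * f 0"
proof -
  note [measurable] = holomorphic_borel_measurable[OF assms(1)]
  have "(LINT z|lborel. f z * of_real (exp (- (cmod z)\<^sup>2)))
      = (LINT z|lborel. LINT t|unit_interval_measure. f (circ t * z) * of_real (exp (- (cmod (circ t * z))\<^sup>2)))"
    by (rule integral_circle_average[symmetric]) (use assms(2) in measurable)
  also have "\<dots> = (LINT z|lborel. f 0 * of_real (exp (- (cmod z)\<^sup>2)))"
    by (simp only: norm_mult norm_cis mult_1_left integral_mult_left_zero circle_mean_value[OF assms(1)])
  also have "\<dots> = f 0 * of_real (LINT z|lborel. exp (- (cmod z)\<^sup>2))"
    by (simp only: integral_mult_right_zero integral_complex_of_real)
  also have "\<dots> = pi * f 0"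
    using gaussian_complex by (simp add: has_bochner_integral_iff)
  finally show ?thesis .
qed

text \<open>Translating by \<open>w\<close> turns the integrand into the entire function
  \<open>g\<close> times the centred Gaussian, and \<open>g 0 = f w\<close>.\<close>

lemma fock_reproducing:
  assumes f: "f \<in> fock_space"
  shows "fock_inner f (fock_kernel w) = f w"
proof -
  define F where "F z = f z * cnj (fock_kernel w z) * of_real (exp (- (cmod z)\<^sup>2))" for z
  have [measurable]: "f \<in> borel_measurable borel" "fock_kernel w \<in> borel_measurable borel"
    using f by (auto intro: fock_space_measurable)
  have [measurable]: "F \<in> borel_measurable borel"
    unfolding F_def by measurable
  have int: "integrable lborel F"
    unfolding F_def using f by (intro fock_inner_integrable) auto
  define g where "g z = f (z + w) * exp (- z * cnj w)" for z
  have g: "g holomorphic_on UNIV"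
    unfolding g_def using fock_space_holomorphic[OF f]
    by (intro holomorphic_intros holomorphic_on_compose_gen[of "\<lambda>z. z + w" UNIV f UNIV, unfolded comp_def]) auto
  have Fg: "F (z + w) = g z * of_real (exp (- (cmod z)\<^sup>2))" for z
  proof -
    have "cnj ((z + w) * cnj w) + of_real (- (cmod (z + w))\<^sup>2) = - z * cnj w + of_real (- (cmod z)\<^sup>2)"
      by (simp only: of_real_minus complex_norm_square) (simp add: algebra_simps)
    then show ?thesis
      unfolding F_def g_def fock_kernel_def by (simp only: exp_cnj mult.assoc exp_of_real[symmetric] exp_add[symmetric])
  qed
  have "(LINT z|lborel. F z) = (LINT z|lborel. g z * of_real (exp (- (cmod z)\<^sup>2)))"
    by (subst integral_lborel_translate[of F w, symmetric]) (simp_all add: Fg)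
  also have "\<dots> = pi * g 0"
    using int integrable_lborel_translate[of F w] by (intro gaussian_mean_value[OF g]) (simp add: Fg)
  finally show ?thesis
    by (simp add: fock_inner_def F_def g_def)
qed

lemma fock_norm_kernel: "fock_norm (fock_kernel w) = exp ((cmod w)\<^sup>2 / 2)"
proof -
  have "fock_norm (fock_kernel w) = sqrt (exp ((cmod w)\<^sup>2))"
    unfolding fock_norm_def
    by (simp add: fock_reproducing) (simp add: fock_kernel_def Re_exp cmod_power2 flip: power2_eq_square)
  also have "\<dots> = sqrt ((exp ((cmod w)\<^sup>2 / 2))\<^sup>2)"
    by (simp add: power2_eq_square mult_exp_exp)
  finally show ?thesis
    by (simp only: real_sqrt_abs abs_exp_cancel)
qed

lemma fock_pointwise_bound:
  assumes "f \<in> fock_space"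
  shows "cmod (f z) \<le> fock_norm f * exp ((cmod z)\<^sup>2 / 2)"
  using fock_cauchy_schwarz[OF assms fock_kernel_in_fock_space, of z]
  by (simp add: fock_reproducing assms fock_norm_kernel)

lemma fock_norm_eq_0:
  assumes "f \<in> fock_space" "fock_norm f = 0"
  shows "f = (\<lambda>z. 0)"
  using fock_pointwise_bound[OF assms(1)] assms(2) by auto

subsection \<open>The shape of a normal weighted composition operator\<close>

lemma exp_mult_cancel:
  fixes a b :: complex
  assumes "\<And>w. exp (a * w) = exp (b * w)"
  shows "a = b"
proof -
  have "((\<lambda>w. exp (a * w)) has_field_derivative a) (at 0)" "((\<lambda>w. exp (b * w)) has_field_derivative b) (at 0)"
    by (auto intro!: derivative_eq_intros)
  then show ?thesis
    using assms by (auto dest: DERIV_unique)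
qed

text \<open>An injective entire function stays away from its value at \<open>0\<close> near infinity, so the reciprocal
  of its difference quotient is a zero-free entire function of linear growth.\<close>

lemma entire_inj_imp_affine:
  assumes hol: "f holomorphic_on UNIV" and inj: "inj f"
  obtains a b where "\<And>z. f z = a * z + b"
proof -
  define k where "k z = (if z = 0 then deriv f 0 else (f z - f 0) / (z - 0))" for z
  have k: "k holomorphic_on UNIV"
    unfolding k_def by (rule pole_lemma[OF hol]) simp
  have "deriv f 0 \<noteq> 0"
    using holomorphic_injective_imp_regular[OF hol open_UNIV inj] by simp
  then have k0: "k z \<noteq> 0" for z
    using inj by (auto simp: k_def dest: injD)
  have "open (f ` ball 0 1)"
    by (rule open_mapping_thm3) (use hol inj in \<open>auto intro: holomorphic_on_subset inj_on_subset\<close>)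
  then obtain d where d: "d > 0" "ball (f 0) d \<subseteq> f ` ball 0 1"
    unfolding open_contains_ball by (metis centre_in_ball imageI zero_less_one)
  \<comment> \<open>All values within \<open>d\<close> of \<open>f 0\<close> are already taken in
    the open unit disc, so injectivity forbids them outside it.\<close>
  have far: "d \<le> cmod (f z - f 0)" if "1 \<le> cmod z" for z
  proof (rule ccontr)
    assume "\<not> d \<le> cmod (f z - f 0)"
    then have "f z \<in> f ` ball 0 1"
      using d by (auto simp: dist_norm norm_minus_commute)
    then show False
      using that inj by (simp add: inj_image_mem_iff)
  qed
  have lin: "cmod (1 / k z) \<le> 1 / d * cmod z ^ 1" if "1 \<le> cmod z" for z
  proof -
    have "cmod (1 / k z) = cmod z / cmod (f z - f 0)"
      using that by (auto simp: k_def norm_divide)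
    also have "\<dots> \<le> cmod z / d"
      using far[OF that] d by (intro frac_le) auto
    finally show ?thesis
      by simp
  qed
  have sum: "1 / k z = (\<Sum>i\<le>1. (deriv ^^ i) (\<lambda>z. 1 / k z) 0 / fact i * z ^ i)" for z
    by (rule Liouville_polynomial[OF _ lin]) (use k k0 in \<open>auto intro!: holomorphic_intros\<close>)
  define c0 c1 where "c0 = 1 / k 0" and "c1 = deriv (\<lambda>z. 1 / k z) 0"
  have c: "1 / k z = c0 + c1 * z" for z
    using sum[of z] by (simp add: c0_def c1_def)
  have "c1 = 0"
  proof (rule ccontr)
    assume "c1 \<noteq> 0"
    then have "1 / k (- c0 / c1) = 0"
      using c by simp
    then show False
      using k0 by simp
  qed
  then have k_eq: "k z = 1 / c0" for z
    using c[of z, symmetric] by simp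
  have "f z = 1 / c0 * z + f 0" for z
  proof (cases "z = 0")
    case False
    then have "f z - f 0 = k z * z"
      by (simp add: k_def)
    then show ?thesis
      by (simp add: k_eq algebra_simps)
  qed simp
  then show ?thesis
    using that by blast
qed

text \<open>Differentiating the functional equation in \<open>h\<close> at 0 gives the linear
  equation \<open>deriv f u = D * f u\<close>.\<close>

lemma multiplicative_entire_imp_exp:
  assumes hol: "f holomorphic_on UNIV" and f0: "f 0 \<noteq> 0"
    and mult: "\<And>u h. f (u + h) * f 0 = f h * f u"
  obtains D where "\<And>z. f z = f 0 * exp (D * z)"
proof -
  define D where "D = deriv f 0 / f 0"
  have der: "(f has_field_derivative deriv f z) (at z)" for z
    using hol by (simp add: holomorphic_derivI)
  have der': "deriv f u = D * f u" for u
  proof -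
    have "((\<lambda>h. f (u + h) * f 0) has_field_derivative deriv f u * f 0) (at 0)"
      using DERIV_shift[of f "deriv f u" 0 u] der[of u] by (auto intro!: derivative_eq_intros simp: add.commute)
    moreover have "((\<lambda>h. f h * f u) has_field_derivative deriv f 0 * f u) (at 0)"
      by (auto intro!: derivative_eq_intros der)
    ultimately have "deriv f u * f 0 = deriv f 0 * f u"
      unfolding mult by (rule DERIV_unique)
    then show ?thesis
      using f0 by (simp add: D_def field_simps)
  qed
  have "((\<lambda>z. f z * exp (- D * z)) has_field_derivative 0) (at z)" for z
    by (auto intro!: derivative_eq_intros der simp: der')
  then have "\<exists>c. \<forall>z\<in>UNIV. f z * exp (- D * z) = c"
    by (intro has_field_derivative_zero_constant) auto
  then obtain c where c: "\<And>z. f z * exp (- D * z) = c"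
    by auto
  have "f z = f 0 * exp (D * z)" for z
    using c[of z] c[of 0] by (simp add: exp_minus field_simps)
  then show ?thesis
    using that by blast
qed

text \<open>The difference \<open>d\<close> is orthogonal to the domain. A domain element
  \<open>f\<close> closer to \<open>d\<close> than \<open>fock_norm d\<close> would give
  \<open>(fock_norm d)\<^sup>2 = cmod (fock_inner (\<lambda>z. d z - f z) d) < (fock_norm
  d)\<^sup>2\<close> unless \<open>d\<close> vanishes.\<close>

lemma fock_dense_orthogonal:
  assumes "densely_defined T" "h1 \<in> fock_space" "h2 \<in> fock_space"
    and eq: "\<And>f. f \<in> op_dom T \<Longrightarrow> fock_inner f h1 = fock_inner f h2"
  shows "h1 = h2"
proof -
  define d where "d = (\<lambda>z. h1 z - h2 z)"
  have d: "d \<in> fock_space"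
    unfolding d_def using assms by (intro fock_space_diff)
  have "fock_norm d = 0"
  proof (rule ccontr)
    assume "fock_norm d \<noteq> 0"
    then have pos: "fock_norm d > 0"
      by (simp add: order_less_le)
    then obtain f where f: "f \<in> op_dom T" "fock_norm (\<lambda>z. d z - f z) < fock_norm d"
      using assms(1) d unfolding densely_defined_def by blast
    have ff: "f \<in> fock_space"
      using f assms(1) by (auto simp: densely_defined_def)
    have "fock_inner f d = 0"
      unfolding d_def using eq[OF f(1)] assms ff by (simp add: fock_inner_diff_right)
    then have "fock_inner d d = fock_inner (\<lambda>z. d z - f z) d"
      using d ff by (simp add: fock_inner_diff_left)
    then have "(fock_norm d)\<^sup>2 = cmod (fock_inner (\<lambda>z. d z - f z) d)"
      by (metis fock_inner_self' norm_of_real abs_power2)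
    also have "\<dots> \<le> fock_norm (\<lambda>z. d z - f z) * fock_norm d"
      using d ff by (intro fock_cauchy_schwarz fock_space_diff)
    also have "\<dots> < fock_norm d * fock_norm d"
      using f pos by (intro mult_strict_right_mono)
    finally show False
      by (simp add: power2_eq_square)
  qed
  then have "d = (\<lambda>z. 0)"
    using d by (intro fock_norm_eq_0)
  then show ?thesis
    by (auto simp: d_def fun_eq_iff)
qed

text \<open>Density makes the description in \<open>adjoint_op\<close> unique, so exhibiting one
  representing element both puts \<open>g\<close> in the domain of the adjoint and computes its
  image.\<close>

lemma
  assumes "densely_defined T" "g \<in> fock_space" "h \<in> fock_space"
    and "\<And>f. f \<in> op_dom T \<Longrightarrow> fock_inner (op_app T f) g = fock_inner f h"
  shows op_dom_adjointI: "g \<in> op_dom (adjoint_op T)"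
    and op_app_adjoint_eq: "op_app (adjoint_op T) g = h"
proof -
  show "g \<in> op_dom (adjoint_op T)"
    using assms by (auto simp: adjoint_op_def op_dom_def)
  have "(THE h. h \<in> fock_space \<and> (\<forall>f\<in>op_dom T. fock_inner (op_app T f) g = fock_inner f h)) = h"
  proof (rule the_equality)
    fix h' assume "h' \<in> fock_space \<and> (\<forall>f\<in>op_dom T. fock_inner (op_app T f) g = fock_inner f h')"
    with assms show "h' = h"
      by (intro fock_dense_orthogonal[of T]) auto
  qed (use assms in auto)
  then show "op_app (adjoint_op T) g = h"
    by (simp add: adjoint_op_def op_app_def)
qed

section \<open>Necessity: testing normality on kernel functions\<close>

lemma op_dom_W_max: "op_dom (W_max \<psi> \<phi>) = {f \<in> fock_space. weighted_comp \<psi> \<phi> f \<in> fock_space}"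
  by (simp add: W_max_def op_dom_def)

lemma op_app_W_max: "op_app (W_max \<psi> \<phi>) = weighted_comp \<psi> \<phi>"
  by (simp add: W_max_def op_app_def)

text \<open>Pairing with a kernel is evaluation, and \<open>\<psi> w * f (\<phi> w)\<close> is
  itself a multiple of an evaluation of \<open>f\<close>, now at \<open>\<phi> w\<close>.\<close>

lemma adjoint_W_max_kernel:
  assumes "densely_defined (W_max \<psi> \<phi>)"
  shows "fock_kernel w \<in> op_dom (adjoint_op (W_max \<psi> \<phi>))"
    and "op_app (adjoint_op (W_max \<psi> \<phi>)) (fock_kernel w) = (\<lambda>z. cnj (\<psi> w) * fock_kernel (\<phi> w) z)"
proof -
  have *: "fock_inner (op_app (W_max \<psi> \<phi>) f) (fock_kernel w)
      = fock_inner f (\<lambda>z. cnj (\<psi> w) * fock_kernel (\<phi> w) z)" if "f \<in> op_dom (W_max \<psi> \<phi>)" for f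
    using that
    by (simp add: op_dom_W_max op_app_W_max fock_reproducing fock_inner_cmult_right)
      (simp add: weighted_comp_def)
  show "fock_kernel w \<in> op_dom (adjoint_op (W_max \<psi> \<phi>))"
    by (rule op_dom_adjointI[OF assms _ _ *]) (auto intro: fock_space_cmult)
  show "op_app (adjoint_op (W_max \<psi> \<phi>)) (fock_kernel w) = (\<lambda>z. cnj (\<psi> w) * fock_kernel (\<phi> w) z)"
    by (rule op_app_adjoint_eq[OF assms _ _ *]) (auto intro: fock_space_cmult)
qed

lemma
  assumes "normal_operator (W_max \<psi> \<phi>)"
  shows normal_W_max_kernel_mem: "weighted_comp \<psi> \<phi> (fock_kernel w) \<in> fock_space"
    and normal_W_max_kernel_norm:
      "fock_norm (weighted_comp \<psi> \<phi> (fock_kernel w)) = cmod (\<psi> w) * exp ((cmod (\<phi> w))\<^sup>2 / 2)"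
proof -
  have dd: "densely_defined (W_max \<psi> \<phi>)"
    using assms by (simp add: normal_operator_def)
  note adj = adjoint_W_max_kernel[OF dd, of w]
  have dom: "fock_kernel w \<in> op_dom (W_max \<psi> \<phi>)"
    using adj assms by (simp add: normal_operator_def)
  then show "weighted_comp \<psi> \<phi> (fock_kernel w) \<in> fock_space"
    by (simp add: op_dom_W_max)
  have "fock_norm (weighted_comp \<psi> \<phi> (fock_kernel w)) = fock_norm (\<lambda>z. cnj (\<psi> w) * fock_kernel (\<phi> w) z)"
    using assms dom adj by (simp add: normal_operator_def op_app_W_max)
  then show "fock_norm (weighted_comp \<psi> \<phi> (fock_kernel w)) = cmod (\<psi> w) * exp ((cmod (\<phi> w))\<^sup>2 / 2)"
    by (simp add: fock_norm_cmult fock_norm_kernel)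
qed

text \<open>This is the point evaluation bound at \<open>z\<close> for the image of
  \<open>fock_kernel w\<close>, whose norm normality identifies with that of the explicit adjoint
  image.\<close>

lemma normal_W_max_bound:
  assumes "normal_operator (W_max \<psi> \<phi>)"
  shows "cmod (\<psi> z) * exp (Re (\<phi> z * cnj w)) \<le> cmod (\<psi> w) * exp ((cmod (\<phi> w))\<^sup>2 / 2) * exp ((cmod z)\<^sup>2 / 2)"
  using fock_pointwise_bound[OF normal_W_max_kernel_mem[OF assms], of w z]
  by (simp add: normal_W_max_kernel_norm[OF assms]) (simp add: weighted_comp_def norm_mult norm_fock_kernel)

lemma mult_exp_le_cancel:
  fixes a b :: real
  shows "a * exp r \<le> b * exp p * exp s \<Longrightarrow> a \<le> b * exp (p + s - r)"
  by (simp add: exp_add exp_diff field_simps)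

lemma le_mult_exp_cancel:
  fixes a b c :: real
  shows "a \<le> b * (exp r * c) \<Longrightarrow> b > 0 \<Longrightarrow> a * exp (- r) / b \<le> c"
  by (simp add: exp_minus field_simps)

lemma exp_minus_divide_eq_cancel:
  fixes x y u v e :: complex
  shows "x * exp (- e) / y = u / v \<Longrightarrow> y \<noteq> 0 \<Longrightarrow> v \<noteq> 0 \<Longrightarrow> x * v = u * y * exp e"
  by (simp add: exp_minus field_simps)

text \<open>A zero at \<open>w\<close> makes the right-hand side of
  \<open>normal_W_max_bound\<close> vanish for every \<open>z\<close>.\<close>

lemma normal_W_max_nonvanishing:
  assumes "normal_operator (W_max \<psi> \<phi>)" "\<exists>z. \<psi> z \<noteq> 0"
  shows "\<psi> w \<noteq> 0"
proof
  assume "\<psi> w = 0"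
  then have "\<psi> z = 0" for z
    using normal_W_max_bound[OF assms(1), of z w] by (simp add: mult_le_0_iff)
  then show False
    using assms(2) by simp
qed

lemma entire_zero_on_open:
  assumes "f holomorphic_on UNIV" "open S" "S \<noteq> {}" "\<And>z. z \<in> S \<Longrightarrow> f z = 0"
  shows "f z = (0::complex)"
proof -
  obtain \<xi> where "\<xi> \<in> S"
    using assms(3) by blast
  then have "\<xi> islimpt S"
    using assms(2) by (simp add: interior_limit_point interior_open)
  then show ?thesis
    using analytic_continuation[of f UNIV S \<xi> z] assms by auto
qed

lemma normal_W_max_inj:
  assumes hol: "\<phi> holomorphic_on UNIV" and N: "normal_operator (W_max \<psi> \<phi>)"
    and nz: "\<exists>z. \<psi> z \<noteq> 0" and nc: "\<not> \<phi> constant_on UNIV"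
  shows "inj \<phi>"
proof (rule injI)
  fix u v assume uv: "\<phi> u = \<phi> v"
  have dd: "densely_defined (W_max \<psi> \<phi>)"
    using N by (simp add: normal_operator_def)
  \<comment> \<open>The coefficients make the adjoint image vanish: both kernels are sent to
    multiples of the same kernel at \<open>\<phi> u = \<phi> v\<close>, with equal total
    coefficients.\<close>
  define g where "g = (\<lambda>z. cnj (\<psi> v) * fock_kernel u z - cnj (\<psi> u) * fock_kernel v z)"
  have g: "g \<in> fock_space"
    unfolding g_def by (intro fock_space_diff fock_space_cmult fock_kernel_in_fock_space)
  have zero: "(\<lambda>z. 0) \<in> fock_space"
    by (simp add: fock_space_def)
  have *: "fock_inner (op_app (W_max \<psi> \<phi>) f) g = fock_inner f (\<lambda>z. 0)" if "f \<in> op_dom (W_max \<psi> \<phi>)" for f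
  proof -
    have "weighted_comp \<psi> \<phi> f \<in> fock_space"
      using that by (simp add: op_dom_W_max)
    then have "fock_inner (weighted_comp \<psi> \<phi> f) g
        = \<psi> v * weighted_comp \<psi> \<phi> f u - \<psi> u * weighted_comp \<psi> \<phi> f v"
      unfolding g_def
      by (simp add: fock_inner_diff_right fock_space_cmult fock_inner_cmult_right fock_reproducing)
    then show ?thesis
      by (simp add: op_app_W_max weighted_comp_def uv) (simp add: fock_inner_def)
  qed
  have "g \<in> op_dom (W_max \<psi> \<phi>)"
    using op_dom_adjointI[OF dd g zero *] N by (simp add: normal_operator_def)
  moreover from this have "fock_norm (weighted_comp \<psi> \<phi> g) = fock_norm (\<lambda>z. 0)"
    using op_app_adjoint_eq[OF dd g zero *] N by (simp add: normal_operator_def op_app_W_max)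
  then have "fock_norm (weighted_comp \<psi> \<phi> g) = 0"
    by (simp add: fock_norm_eq)
  ultimately have "weighted_comp \<psi> \<phi> g = (\<lambda>z. 0)"
    by (intro fock_norm_eq_0) (auto simp: op_dom_W_max)
  then have "\<psi> z * g (\<phi> z) = 0" for z
    by (auto simp: weighted_comp_def fun_eq_iff)
  then have g\<phi>: "g (\<phi> z) = 0" for z
    using normal_W_max_nonvanishing[OF N nz] by simp
  \<comment> \<open>\<open>g\<close> vanishes on the range of the nonconstant \<open>\<phi>\<close>,
    which is open by the open mapping theorem, so \<open>g\<close> vanishes identically.\<close>
  have op: "open (range \<phi>)"
    using hol nc by (intro open_mapping_thm[of \<phi> UNIV UNIV]) auto
  have g0: "g z = 0" for z
    by (rule entire_zero_on_open[OF fock_space_holomorphic[OF g] op]) (use g\<phi> in auto)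
  \<comment> \<open>At 0 both kernels equal 1, so \<open>g 0 = 0\<close> compares the coefficients;
    the kernels themselves then agree.\<close>
  have "\<psi> u = \<psi> v"
    using g0[of 0] by (simp add: g_def fock_kernel_def)
  then have "exp (cnj u * z) = exp (cnj v * z)" for z
    using g0[of z] normal_W_max_nonvanishing[OF N nz, of v]
    by (simp add: g_def fock_kernel_def mult.commute)
  then show "u = v"
    using exp_mult_cancel[of "cnj u" "cnj v"] by simp
qed

lemma normal_W_max_affine:
  assumes hol: "\<phi> holomorphic_on UNIV" and N: "normal_operator (W_max \<psi> \<phi>)" and nz: "\<exists>z. \<psi> z \<noteq> 0"
  obtains A B where "\<And>z. \<phi> z = A * z + B"
proof (cases "\<phi> constant_on UNIV")
  case True
  then obtain B where "\<And>z. \<phi> z = 0 * z + B"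
    by (auto simp: constant_on_def)
  then show ?thesis
    using that by blast
next
  case False
  then show ?thesis
    using entire_inj_imp_affine[OF hol normal_W_max_inj[OF hol N nz]] that by metis
qed

text \<open>The pointwise bound along \<open>z = cnj A * w + h\<close> has matching Gaussian factors on both sides, so
  Liouville's theorem applies to the quotient.\<close>

lemma normal_W_max_functional_equation:
  assumes hol: "\<psi> holomorphic_on UNIV" and N: "normal_operator (W_max \<psi> \<phi>)" and nz: "\<exists>z. \<psi> z \<noteq> 0"
    and \<phi>: "\<And>z. \<phi> z = A * z + B"
  shows "\<psi> (cnj A * w + h) * \<psi> 0 = \<psi> h * \<psi> w * exp ((A - 1) * cnj B * w)"
proof -
  note nv = normal_W_max_nonvanishing[OF N nz]
  \<comment> \<open>The exponential removes the part of the exponent \<open>E\<close> that is linear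
    in \<open>w\<close>; the quadratic terms cancel, and the remaining bound does not depend on
    \<open>w\<close>.\<close>
  define q where "q w = \<psi> (cnj A * w + h) * exp (- ((A - 1) * cnj B * w)) / \<psi> w" for w
  have q: "q holomorphic_on UNIV"
    unfolding q_def using hol nv
    by (intro holomorphic_intros holomorphic_on_compose_gen[of "\<lambda>w. cnj A * w + h" UNIV \<psi> UNIV, unfolded comp_def]) auto
  have "cmod (q w) \<le> exp ((cmod B)\<^sup>2 / 2 + (cmod h)\<^sup>2 / 2)" for w
  proof -
    define z where "z = cnj A * w + h"
    have E: "(cmod (\<phi> w))\<^sup>2 / 2 + (cmod z)\<^sup>2 / 2 - Re (\<phi> z * cnj w)
        = Re ((A - 1) * cnj B * w) + ((cmod B)\<^sup>2 / 2 + (cmod h)\<^sup>2 / 2)"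
      unfolding \<phi> z_def cmod_power2 by (simp add: algebra_simps power2_eq_square add_divide_distrib diff_divide_distrib)
    have "cmod (\<psi> z) \<le> cmod (\<psi> w) * exp ((cmod (\<phi> w))\<^sup>2 / 2 + (cmod z)\<^sup>2 / 2 - Re (\<phi> z * cnj w))"
      by (rule mult_exp_le_cancel[OF normal_W_max_bound[OF N]])
    then have "cmod (\<psi> z) \<le> cmod (\<psi> w) * (exp (Re ((A - 1) * cnj B * w)) * exp ((cmod B)\<^sup>2 / 2 + (cmod h)\<^sup>2 / 2))"
      unfolding E by (simp only: exp_add)
    then have "cmod (\<psi> z) * exp (- Re ((A - 1) * cnj B * w)) / cmod (\<psi> w) \<le> exp ((cmod B)\<^sup>2 / 2 + (cmod h)\<^sup>2 / 2)"
      using nv[of w] by (intro le_mult_exp_cancel) auto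
    then show ?thesis
      by (simp only: q_def z_def norm_mult norm_divide norm_exp_eq_Re uminus_complex.sel)
  qed
  then have "bounded (range q)"
    by (auto simp: bounded_iff)
  then have "q constant_on UNIV"
    by (rule Liouville_theorem[OF q])
  then have "q w = q 0"
    by (metis UNIV_I constant_on_def)
  then show ?thesis
    using nv[of w] nv[of 0] by (intro exp_minus_divide_eq_cancel) (simp_all add: q_def)
qed

lemma normal_W_max_imp_form:
  assumes hol\<phi>: "\<phi> holomorphic_on UNIV" and hol: "\<psi> holomorphic_on UNIV"
    and N: "normal_operator (W_max \<psi> \<phi>)" and nz: "\<exists>z. \<psi> z \<noteq> 0"
  obtains A B C D where "\<And>z. \<phi> z = A * z + B" "\<And>z. \<psi> z = C * exp (D * z)"
    "A \<noteq> 1 \<Longrightarrow> D = cnj B * (1 - A) * inverse (1 - cnj A)" "A = 1 \<Longrightarrow> cmod B = cmod D"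
proof -
  note nv = normal_W_max_nonvanishing[OF N nz]
  obtain A B where \<phi>: "\<And>z. \<phi> z = A * z + B"
    using normal_W_max_affine[OF hol\<phi> N nz] by blast
  note fe = normal_W_max_functional_equation[OF hol N nz \<phi>]
  show ?thesis
  proof (cases "A = 0")
    case True
    \<comment> \<open>For a constant \<open>\<phi>\<close> the functional equation at
      \<open>h = 0\<close> already determines \<open>\<psi>\<close>, with
      \<open>D = cnj B\<close>.\<close>
    have "\<psi> w = \<psi> 0 * exp (cnj B * w)" for w
      using fe[of w 0] True nv[of 0] by (simp add: exp_minus field_simps)
    from that[OF \<phi> this] show ?thesis
      using True by simp
  next
    case False
    have fe0: "\<psi> (cnj A * w) = \<psi> w * exp ((A - 1) * cnj B * w)" for w
      using fe[of w 0] nv[of 0] by simp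
    \<comment> \<open>Substituting \<open>w = u / cnj A\<close> and using the case
      \<open>h = 0\<close> absorbs the exponential factor.\<close>
    have "\<psi> (u + h) * \<psi> 0 = \<psi> h * \<psi> u" for u h
      using fe[of "u / cnj A" h] fe0[of "u / cnj A"] False by simp
    then obtain D where D: "\<And>z. \<psi> z = \<psi> 0 * exp (D * z)"
      using multiplicative_entire_imp_exp[OF hol nv] by blast
    \<comment> \<open>Inserting the exponential form of \<open>\<psi>\<close> back into the case
      \<open>h = 0\<close> yields the relation between \<open>D\<close> and
      \<open>B\<close>.\<close>
    have "exp ((D * cnj A) * w) = exp ((D + (A - 1) * cnj B) * w)" for w
      using fe0[of w] D[of "cnj A * w"] D[of w] nv[of 0] by (simp add: distrib_right exp_add mult.assoc)
    then have "D * cnj A = D + (A - 1) * cnj B"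
      by (rule exp_mult_cancel)
    then have *: "D * (1 - cnj A) = cnj B * (1 - A)"
      by (simp add: algebra_simps)
    have 1: "D = cnj B * (1 - A) * inverse (1 - cnj A)" if "A \<noteq> 1"
    proof -
      have "1 - cnj A \<noteq> 0"
        using that by (metis complex_cnj_cnj complex_cnj_one eq_iff_diff_eq_0)
      then show ?thesis
        using * by (simp add: field_simps)
    qed
    \<comment> \<open>For \<open>A = 1\<close> the relation reads \<open>0 = 0\<close>. The missing
      condition comes from equating the norms of the images of \<open>fock_kernel 0\<close>, the
      constant 1, under the operator and its adjoint.\<close>
    have 2: "cmod B = cmod D" if "A = 1"
    proof -
      have "weighted_comp \<psi> \<phi> (fock_kernel 0) = (\<lambda>z. \<psi> 0 * fock_kernel (cnj D) z)"
      proof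
        fix z
        show "weighted_comp \<psi> \<phi> (fock_kernel 0) z = \<psi> 0 * fock_kernel (cnj D) z"
          using D[of z] by (simp add: weighted_comp_def fock_kernel_def mult.commute)
      qed
      then have "cmod (\<psi> 0) * exp ((cmod D)\<^sup>2 / 2) = cmod (\<psi> 0) * exp ((cmod B)\<^sup>2 / 2)"
        using normal_W_max_kernel_norm[OF N, of 0] by (simp add: fock_norm_cmult fock_norm_kernel \<phi>)
      then show ?thesis
        using nv[of 0] by simp
    qed
    show ?thesis
      using that[OF \<phi> D 1 2] by blast
  qed
qed

subsection \<open>Closedness, density and formal adjoints\<close>

text \<open>Norm convergence implies pointwise convergence, and weighted composition respects
  pointwise limits; the two limits of the images must therefore coincide.\<close>

lemma closed_operator_W_max: "closed_operator (W_max \<psi> \<phi>)"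
  unfolding closed_operator_def
proof (intro allI impI, elim conjE)
  fix F f g
  assume F: "\<forall>n::nat. F n \<in> op_dom (W_max \<psi> \<phi>)" and f: "f \<in> fock_space" and g: "g \<in> fock_space"
    and Ff: "(\<lambda>n. fock_norm (\<lambda>z. F n z - f z)) \<longlonglongrightarrow> 0"
    and Fg: "(\<lambda>n. fock_norm (\<lambda>z. op_app (W_max \<psi> \<phi>) (F n) z - g z)) \<longlonglongrightarrow> 0"
  have pointwise: "(\<lambda>n. H n z) \<longlonglongrightarrow> h z"
    if "\<And>n. H n \<in> fock_space" "h \<in> fock_space" "(\<lambda>n. fock_norm (\<lambda>z. H n z - h z)) \<longlonglongrightarrow> 0"
    for H :: "nat \<Rightarrow> complex \<Rightarrow> complex" and h z
  proof (rule Lim_transform_bound[where g = "\<lambda>n. fock_norm (\<lambda>z. H n z - h z) * exp ((cmod z)\<^sup>2 / 2)", THEN LIM_zero_cancel])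
    show "\<forall>\<^sub>F n in sequentially. norm (H n z - h z) \<le> norm (fock_norm (\<lambda>z. H n z - h z) * exp ((cmod z)\<^sup>2 / 2))"
      using fock_pointwise_bound[OF fock_space_diff[OF that(1,2)]] by (simp add: abs_mult)
    show "(\<lambda>n. fock_norm (\<lambda>z. H n z - h z) * exp ((cmod z)\<^sup>2 / 2)) \<longlonglongrightarrow> 0"
      using that(3) by (rule tendsto_mult_left_zero)
  qed
  have "weighted_comp \<psi> \<phi> f z = g z" for z
  proof (rule LIMSEQ_unique)
    show "(\<lambda>n. weighted_comp \<psi> \<phi> (F n) z) \<longlonglongrightarrow> weighted_comp \<psi> \<phi> f z"
      unfolding weighted_comp_def using F f Ff
      by (intro tendsto_mult tendsto_const pointwise) (auto simp: op_dom_W_max)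
    show "(\<lambda>n. weighted_comp \<psi> \<phi> (F n) z) \<longlonglongrightarrow> g z"
      using F g Fg by (intro pointwise) (auto simp: op_dom_W_max op_app_W_max)
  qed
  then have "weighted_comp \<psi> \<phi> f = g"
    by auto
  then show "f \<in> op_dom (W_max \<psi> \<phi>) \<and> op_app (W_max \<psi> \<phi>) f = g"
    using f g by (simp add: op_dom_W_max op_app_W_max)
qed

section \<open>Density of the domain via Taylor polynomials\<close>

lemma power_le_fact_exp:
  fixes x :: real
  assumes "0 \<le> x"
  shows "x ^ n \<le> fact n * exp x"
proof -
  have "(\<Sum>k\<in>{n}. x ^ k /\<^sub>R fact k) \<le> exp x"
    unfolding exp_def using assms by (intro sum_le_suminf summable_exp_generic) auto
  then show ?thesis
    by (simp add: field_simps)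
qed

lemma polynomial_exponential_type:
  fixes a :: "nat \<Rightarrow> complex"
  obtains M where "\<And>z. cmod (\<Sum>n<N. a n * z ^ n) \<le> M * exp (cmod z)"
proof
  fix z :: complex
  have "cmod (\<Sum>n<N. a n * z ^ n) \<le> (\<Sum>n<N. cmod (a n) * (fact n * exp (cmod z)))"
    by (intro sum_norm_le) (simp add: norm_mult norm_power mult_left_mono power_le_fact_exp)
  then show "cmod (\<Sum>n<N. a n * z ^ n) \<le> (\<Sum>n<N. cmod (a n) * fact n) * exp (cmod z)"
    by (simp add: sum_distrib_right mult.assoc)
qed

text \<open>By Parseval, the circle average \<open>P N\<close> of the squared Taylor remainder is a
  tail of a convergent series of nonnegative terms. The tails tend to 0 pointwise and lie below the
  integrable \<open>P 0\<close>, so dominated convergence sends the norms of the remainders to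
  0.\<close>

lemma fock_taylor_dense:
  assumes f: "f \<in> fock_space" and "\<epsilon> > 0"
  obtains a N where "fock_norm (\<lambda>z. f z - (\<Sum>n<N. a n * z ^ n)) < \<epsilon>"
proof -
  define a where "a n = (deriv ^^ n) f 0 / fact n" for n
  have a: "(\<lambda>n. a n * z ^ n) sums f z" for z
    unfolding a_def by (rule entire_power_series[OF fock_space_holomorphic[OF f]])
  define R where "R N z = f z - (\<Sum>n<N. a n * z ^ n)" for N z
  have poly: "(\<lambda>z. \<Sum>n<N. a n * z ^ n) \<in> fock_space" for N
  proof -
    obtain M where "\<And>z. cmod (\<Sum>n<N. a n * z ^ n) \<le> M * exp (cmod z)"
      using polynomial_exponential_type[of a N] by blast
    then show ?thesis
      by (intro fock_space_exponential_type[where M = M and k = 1] holomorphic_intros) auto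
  qed
  have R: "R N \<in> fock_space" for N
    unfolding R_def by (intro fock_space_diff f poly)
  note [measurable] = fock_space_measurable[OF R]
  have R_sums: "(\<lambda>n. (if n < N then 0 else a n) * z ^ n) sums R N z" for N z
  proof -
    have "(\<lambda>n. (if n < N then a n * z ^ n else 0)) sums (\<Sum>n<N. a n * z ^ n)"
      using sums_If_finite_set[of "{..<N}" "\<lambda>n. a n * z ^ n"] by simp
    from sums_diff[OF a this] show ?thesis
      unfolding R_def by (rule sums_cong[THEN iffD1, rotated]) auto
  qed
  define P where "P N z = (LINT t|unit_interval_measure. (cmod (R N (circ t * z)))\<^sup>2)" for N z
  have P: "(\<lambda>n. if n < N then 0 else (cmod (a n))\<^sup>2 * cmod z ^ (2 * n)) sums P N z" for N z
  proof -
    have "(\<lambda>n. (if n < N then 0 else a n) * cnj (if n < N then 0 else a n) * of_real (cmod z ^ (2 * n)))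
        sums (LINT t|unit_interval_measure. R N (circ t * z) * cnj (R N (circ t * z)))"
      by (intro circle_parseval R_sums holomorphic_on_imp_continuous_on fock_space_holomorphic R)
    also have "(\<lambda>n. (if n < N then 0 else a n) * cnj (if n < N then 0 else a n) * of_real (cmod z ^ (2 * n)))
        = (\<lambda>n. complex_of_real (if n < N then 0 else (cmod (a n))\<^sup>2 * cmod z ^ (2 * n)))"
      by (auto simp: complex_norm_square[unfolded of_real_power])
    also have "(LINT t|unit_interval_measure. R N (circ t * z) * cnj (R N (circ t * z))) = complex_of_real (P N z)"
      unfolding P_def by (simp only: complex_norm_square[symmetric] integral_complex_of_real)
    finally show ?thesis
      by (simp only: sums_of_real_iff)
  qed
  have norm_R: "(fock_norm (R N))\<^sup>2 = (LINT z|lborel. P N z * exp (- (cmod z)\<^sup>2)) / pi"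
    and int_R: "integrable lborel (\<lambda>z. P N z * exp (- (cmod z)\<^sup>2))" for N
    using integral_circle_average[OF _ fock_space_integrable[OF R], of N]
      integrable_circle_average[OF _ fock_space_integrable[OF R], of N]
    by (simp_all add: norm_mult fock_norm_power2 P_def)
  have P_nonneg: "0 \<le> P N z" for N z
    unfolding P_def by simp
  have P_le: "P N z \<le> P 0 z" for N z
    by (rule sums_le[OF _ P P]) simp
  have P_lim: "(\<lambda>N. P N z) \<longlonglongrightarrow> 0" for z
  proof -
    define b where "b n = (cmod (a n))\<^sup>2 * cmod z ^ (2 * n)" for n
    have b: "b sums P 0 z"
      using P[of 0 z] by (simp add: b_def[abs_def])
    have "P N z = P 0 z - (\<Sum>n<N. b n)" for N
    proof -
      have "(\<lambda>n. (if n < N then b n else 0)) sums (\<Sum>n<N. b n)"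
        using sums_If_finite_set[of "{..<N}" b] by simp
      from sums_diff[OF b this] have "(\<lambda>n. if n < N then 0 else b n) sums (P 0 z - (\<Sum>n<N. b n))"
        by (rule sums_cong[THEN iffD1, rotated]) auto
      then show ?thesis
        using P[of N z] sums_unique2 unfolding b_def by blast
    qed
    then have eq: "(\<lambda>N. P N z) = (\<lambda>N. P 0 z - (\<Sum>n<N. b n))"
      by (rule ext)
    have "(\<lambda>N. P 0 z - (\<Sum>n<N. b n)) \<longlonglongrightarrow> P 0 z - P 0 z"
      using b unfolding sums_def by (intro tendsto_diff tendsto_const)
    then show ?thesis
      unfolding eq by simp
  qed
  have "(\<lambda>N. LINT z|lborel. P N z * exp (- (cmod z)\<^sup>2)) \<longlonglongrightarrow> (LINT z|(lborel :: complex measure). 0)"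
  proof (rule integral_dominated_convergence[where w = "\<lambda>z. P 0 z * exp (- (cmod z)\<^sup>2)"])
    show "AE z in lborel. (\<lambda>N. P N z * exp (- (cmod z)\<^sup>2)) \<longlonglongrightarrow> 0"
      using P_lim by (intro AE_I2 tendsto_mult_left_zero)
    show "AE z in lborel. norm (P N z * exp (- (cmod z)\<^sup>2)) \<le> P 0 z * exp (- (cmod z)\<^sup>2)" for N
      using P_nonneg P_le by (intro AE_I2) (simp add: abs_mult)
  qed (use int_R in auto)
  then have "(\<lambda>N. (LINT z|lborel. P N z * exp (- (cmod z)\<^sup>2)) / pi) \<longlonglongrightarrow> 0 / pi"
    by (intro tendsto_divide tendsto_const) auto
  then have "(\<lambda>N. (fock_norm (R N))\<^sup>2) \<longlonglongrightarrow> 0"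
    by (simp add: norm_R)
  then have "\<forall>\<^sub>F N in sequentially. (fock_norm (R N))\<^sup>2 < \<epsilon>\<^sup>2"
    by (rule order_tendstoD(2)) (use assms(2) in simp)
  then obtain N where "(fock_norm (R N))\<^sup>2 < \<epsilon>\<^sup>2"
    by (meson eventually_sequentially order_refl)
  then have "fock_norm (R N) < \<epsilon>"
    using assms(2) by (intro power2_less_imp_less[of _ \<epsilon>]) auto
  then show ?thesis
    using that[of a N] unfolding R_def by blast
qed

lemma holomorphic_on_compose_entire:
  assumes "f holomorphic_on UNIV" "g holomorphic_on UNIV"
  shows "(\<lambda>z. f (g z)) holomorphic_on UNIV"
  using holomorphic_on_compose_gen[OF assms(2,1)] by (simp add: comp_def)

text \<open>An affine substitution and an exponential weight turn a polynomial into a function of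
  exponential type, so all polynomials lie in the domain.\<close>

lemma densely_defined_W_max_affine:
  assumes \<psi>: "\<And>z. \<psi> z = C * exp (D * z)" and \<phi>: "\<And>z. \<phi> z = A * z + B"
  shows "densely_defined (W_max \<psi> \<phi>)"
  unfolding densely_defined_def
proof (intro conjI ballI allI impI)
  show "op_dom (W_max \<psi> \<phi>) \<subseteq> fock_space"
    by (auto simp: op_dom_W_max)
  fix f :: "complex \<Rightarrow> complex" and \<epsilon> :: real
  assume "f \<in> fock_space" "\<epsilon> > 0"
  then obtain a N where aN: "fock_norm (\<lambda>z. f z - (\<Sum>n<N. a n * z ^ n)) < \<epsilon>"
    using fock_taylor_dense by blast
  define S where "S z = (\<Sum>n<N. a n * z ^ n)" for z
  obtain M where M: "\<And>z. cmod (S z) \<le> M * exp (cmod z)"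
    unfolding S_def using polynomial_exponential_type[of a N] by blast
  have S: "S holomorphic_on UNIV"
    unfolding S_def by (intro holomorphic_intros)
  have M0: "0 \<le> M"
    using order_trans[OF norm_ge_zero M[of 0]] by simp
  have "S \<in> fock_space"
    using S M by (intro fock_space_exponential_type[where M = M and k = 1]) auto
  moreover have "weighted_comp \<psi> \<phi> S \<in> fock_space"
  proof (rule fock_space_exponential_type)
    show "weighted_comp \<psi> \<phi> S holomorphic_on UNIV"
      unfolding weighted_comp_def \<psi> \<phi> by (intro holomorphic_intros holomorphic_on_compose_entire[OF S])
    fix z
    have "cmod (weighted_comp \<psi> \<phi> S z) = cmod C * exp (Re (D * z)) * cmod (S (A * z + B))"
      by (simp add: weighted_comp_def \<psi> \<phi> norm_mult)
    also have "\<dots> \<le> cmod C * exp (cmod D * cmod z) * (M * exp (cmod A * cmod z + cmod B))"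
    proof (intro mult_mono mult_left_mono)
      show "exp (Re (D * z)) \<le> exp (cmod D * cmod z)"
        using complex_Re_le_cmod[of "D * z"] by (simp add: norm_mult)
      have "cmod (A * z + B) \<le> cmod A * cmod z + cmod B"
        using norm_triangle_ineq[of "A * z" B] by (simp add: norm_mult)
      then show "cmod (S (A * z + B)) \<le> M * exp (cmod A * cmod z + cmod B)"
        using M[of "A * z + B"] M0 by (elim order_trans) (auto intro: mult_left_mono)
    qed auto
    also have "\<dots> = (cmod C * M * exp (cmod B)) * exp ((cmod D + cmod A) * cmod z)"
      by (simp add: exp_add distrib_right)
    finally show "cmod (weighted_comp \<psi> \<phi> S z) \<le> (cmod C * M * exp (cmod B)) * exp ((cmod D + cmod A) * cmod z)" .
  qed
  ultimately have "S \<in> op_dom (W_max \<psi> \<phi>)"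
    by (simp add: op_dom_W_max)
  then show "\<exists>g\<in>op_dom (W_max \<psi> \<phi>). fock_norm (\<lambda>z. f z - g z) < \<epsilon>"
    using aN by (intro bexI[of _ S]) (simp_all add: S_def)
qed

text \<open>On each circle both averages equal the series with terms
  \<open>a n * A ^ n * cnj (b n) * cmod z ^ (2 * n)\<close>. Comparing circle by circle keeps the
  exchange of sum and integral on compact sets; over the plane only the integrability of the two
  whole integrands is used.\<close>

lemma dilation_adjoint:
  assumes F: "F holomorphic_on UNIV" and G: "G holomorphic_on UNIV"
    and I1: "integrable lborel (\<lambda>z. F (A * z) * cnj (G z) * of_real (exp (- (cmod z)\<^sup>2)))"
    and I2: "integrable lborel (\<lambda>z. F z * cnj (G (cnj A * z)) * of_real (exp (- (cmod z)\<^sup>2)))"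
  shows "(LINT z|lborel. F (A * z) * cnj (G z) * of_real (exp (- (cmod z)\<^sup>2)))
    = (LINT z|lborel. F z * cnj (G (cnj A * z)) * of_real (exp (- (cmod z)\<^sup>2)))"
proof -
  note [measurable] = F[THEN holomorphic_borel_measurable] G[THEN holomorphic_borel_measurable]
  define a where "a n = (deriv ^^ n) F 0 / fact n" for n
  define b where "b n = (deriv ^^ n) G 0 / fact n" for n
  have a: "(\<lambda>n. a n * z ^ n) sums F z" and b: "(\<lambda>n. b n * z ^ n) sums G z" for z
    unfolding a_def b_def by (rule entire_power_series F G)+
  have a': "(\<lambda>n. a n * A ^ n * z ^ n) sums F (A * z)" and b': "(\<lambda>n. b n * cnj A ^ n * z ^ n) sums G (cnj A * z)" for z
    using a[of "A * z"] b[of "cnj A * z"] by (simp_all add: power_mult_distrib mult.assoc)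
  have cont: "continuous_on UNIV F" "continuous_on UNIV G"
      "continuous_on UNIV (\<lambda>z. F (A * z))" "continuous_on UNIV (\<lambda>z. G (cnj A * z))"
    by (intro holomorphic_on_imp_continuous_on F G holomorphic_on_compose_entire[OF F]
        holomorphic_on_compose_entire[OF G] holomorphic_intros)+
  have avg: "(LINT t|unit_interval_measure. F (A * (circ t * z)) * cnj (G (circ t * z)))
      = (LINT t|unit_interval_measure. F (circ t * z) * cnj (G (cnj A * (circ t * z))))" for z
  proof (rule sums_unique2)
    show "(\<lambda>n. a n * A ^ n * cnj (b n) * of_real (cmod z ^ (2 * n)))
        sums (LINT t|unit_interval_measure. F (A * (circ t * z)) * cnj (G (circ t * z)))"
      by (rule circle_parseval[OF a' b cont(3) cont(2)])
    show "(\<lambda>n. a n * A ^ n * cnj (b n) * of_real (cmod z ^ (2 * n)))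
        sums (LINT t|unit_interval_measure. F (circ t * z) * cnj (G (cnj A * (circ t * z))))"
      using circle_parseval[OF a b' cont(1) cont(4), of z] by (simp add: mult_ac)
  qed
  have "(LINT z|lborel. F (A * z) * cnj (G z) * of_real (exp (- (cmod z)\<^sup>2)))
      = (LINT z|lborel. LINT t|unit_interval_measure.
          F (A * (circ t * z)) * cnj (G (circ t * z)) * of_real (exp (- (cmod (circ t * z))\<^sup>2)))"
    by (rule integral_circle_average[symmetric]) (use I1 in measurable)
  also have "\<dots> = (LINT z|lborel. LINT t|unit_interval_measure.
          F (circ t * z) * cnj (G (cnj A * (circ t * z))) * of_real (exp (- (cmod (circ t * z))\<^sup>2)))"
    by (simp only: norm_mult norm_cis mult_1_left integral_mult_left_zero avg)
  also have "\<dots> = (LINT z|lborel. F z * cnj (G (cnj A * z)) * of_real (exp (- (cmod z)\<^sup>2)))"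
    by (rule integral_circle_average) (use I2 in measurable)
  finally show ?thesis .
qed

section \<open>Contour shifts for a twisted pairing\<close>

lemma AE_unit_interval: "AE t in unit_interval_measure. 0 \<le> t \<and> t \<le> 1"
  unfolding unit_interval_measure_def by (subst AE_density) (auto intro!: AE_I2 split: split_indicator)

text \<open>Conjugating both argument and value preserves holomorphy; this makes the antiholomorphic
  factor of the pairing holomorphic in the shift parameter.\<close>

lemma holomorphic_cnj_reflect:
  assumes r: "r holomorphic_on UNIV"
  shows "(\<lambda>\<zeta>. cnj (r (z - e * cnj \<zeta>))) holomorphic_on UNIV"
proof -
  have "(\<lambda>w. r (z - e * w)) holomorphic_on UNIV"
    by (intro holomorphic_on_compose_entire[OF r] holomorphic_intros)
  then have "cnj \<circ> (\<lambda>w. r (z - e * w)) \<circ> cnj holomorphic_on UNIV"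
    by (intro holomorphic_on_compose_cnj_cnj) (auto intro: holomorphic_on_subset)
  then show ?thesis
    by (simp add: comp_def)
qed

text \<open>Cauchy's theorem for the unit square in the form right minus left equals top minus
  bottom, obtained from the endpoint values of an entire primitive.\<close>

lemma rectangle_integral:
  assumes F: "F holomorphic_on UNIV"
  shows "\<i> * (LINT t|unit_interval_measure. F (1 + \<i> * of_real t)) - \<i> * (LINT t|unit_interval_measure. F (0 + \<i> * of_real t))
    = (LINT t|unit_interval_measure. F (\<i> + 1 * of_real t)) - (LINT t|unit_interval_measure. F (0 + 1 * of_real t))"
proof -
  obtain G where G: "\<And>z. (G has_field_derivative F z) (at z)"
    using holomorphic_convex_primitive'[of UNIV F] F by auto
  have cont: "continuous_on S F" for S
    using holomorphic_on_imp_continuous_on[OF F] continuous_on_subset by blast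
  have FTC: "b * (LINT t|unit_interval_measure. F (a + b * of_real t)) = G (a + b) - G a" for a b
  proof -
    have "((\<lambda>t. G (a + b * of_real t)) has_vector_derivative b * F (a + b * of_real t)) (at t within S)" for t S
    proof -
      have "((\<lambda>w. G (a + b * w)) has_field_derivative F (a + b * of_real t) * b) (at (of_real t))"
        by (rule DERIV_chain2[OF G]) (auto intro!: derivative_eq_intros)
      from has_vector_derivative_real_field[OF this] show ?thesis
        by (simp add: mult.commute has_vector_derivative_at_within)
    qed
    moreover have "continuous_on {0..1} (\<lambda>t. b * F (a + b * of_real t))"
      by (intro continuous_intros continuous_on_compose2[OF cont[of UNIV]]) auto
    ultimately have "(LINT t|lborel. indicator {0..1} t *\<^sub>R (b * F (a + b * of_real t))) = G (a + b * of_real 1) - G (a + b * of_real 0)"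
      by (intro integral_FTC_atLeastAtMost) auto
    moreover have "(\<lambda>t. b * F (a + b * of_real t)) \<in> borel_measurable borel"
      by (intro borel_measurable_continuous_onI continuous_intros continuous_on_compose2[OF cont[of UNIV]]) auto
    ultimately show ?thesis
      using integral_unit_interval[of "\<lambda>t. b * F (a + b * of_real t)"] by simp
  qed
  show ?thesis
    unfolding FTC using FTC[where a = \<i> and b = 1] FTC[where a = 0 and b = 1] by (simp add: add.commute)
qed

lemma Re_mult_cnj_shift: "Re ((z + h) * cnj z) = ((cmod (z + h))\<^sup>2 + (cmod z)\<^sup>2 - (cmod h)\<^sup>2) / 2"
  unfolding cmod_power2 by (simp add: algebra_simps power2_eq_square add_divide_distrib diff_divide_distrib)

text \<open>With \<open>w = z + h\<close>, the integrand \<open>p w * cnj (r z) * exp (- w * cnj z)\<close> is holomorphic in \<open>w\<close> and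
  antiholomorphic in \<open>z\<close>. Moving \<open>w\<close> and \<open>z\<close> symmetrically by a complex multiple \<open>\<zeta>\<close> of \<open>h / 2\<close> is
  holomorphic in \<open>\<zeta>\<close>, and the imaginary part of \<open>\<zeta>\<close> only translates the plane; integrating over the boundary of
  the unit square in \<open>\<zeta>\<close> shows that the real part does not matter either.\<close>

lemma integral_twisted_translate:
  assumes p: "p holomorphic_on UNIV" and r: "r holomorphic_on UNIV"
    and P: "(\<lambda>z. p z * exp (t * z)) \<in> fock_space" and R: "(\<lambda>z. r z * exp (- t * z)) \<in> fock_space"
  shows "(LINT z|lborel. p (z + h) * cnj (r z) * exp (- (z + h) * cnj z))
      = (LINT z|lborel. p z * cnj (r z) * exp (- z * cnj z))"
proof -
  note [measurable] = p[THEN holomorphic_borel_measurable] r[THEN holomorphic_borel_measurable]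
  define Q where "Q h z = p (z + h) * cnj (r z) * exp (- (z + h) * cnj z)" for h z
  have [measurable]: "(\<lambda>x. Q (f x) (g x)) \<in> borel_measurable M"
    if [measurable]: "f \<in> borel_measurable M" "g \<in> borel_measurable M" for f g and M :: "'x measure"
    unfolding Q_def by measurable
  have Q_meas: "Q h \<in> borel_measurable borel" for h
    using measurable_ident by measurable
  have Q_norm_meas: "(\<lambda>z. cmod (Q h z)) \<in> borel_measurable borel" for h
    using Q_meas by measurable
  define N1 where "N1 z = (cmod (p z * exp (t * z)))\<^sup>2 * exp (- (cmod z)\<^sup>2)" for z
  define N2 where "N2 z = (cmod (r z * exp (- t * z)))\<^sup>2 * exp (- (cmod z)\<^sup>2)" for z
  have [measurable]: "N1 \<in> borel_measurable borel" "N2 \<in> borel_measurable borel"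
    unfolding N1_def N2_def by measurable
  have N1: "integrable lborel N1" and N2: "integrable lborel N2"
    unfolding N1_def N2_def using P R by (simp_all only: fock_space_integrable)
  \<comment> \<open>The factor left over when the exponent of \<open>Q h z\<close> is split into
    half a Gaussian at \<open>z + h\<close>, half a Gaussian at \<open>z\<close>, and the opposite
    exponentials with \<open>t\<close> and \<open>- t\<close>; the mixed product is then bounded by
    the two squares.\<close>
  define c where "c h = exp ((cmod h)\<^sup>2 / 2 - Re (t * h))" for h
  have bound: "cmod (Q h z) \<le> c h * (N1 (z + h) + N2 z)" for h z
  proof -
    define x where "x = cmod (p (z + h) * exp (t * (z + h))) * exp (- (cmod (z + h))\<^sup>2 / 2)"
    define y where "y = cmod (r z * exp (- t * z)) * exp (- (cmod z)\<^sup>2 / 2)"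
    have "cmod (Q h z) = cmod (p (z + h)) * cmod (r z) * exp (- Re ((z + h) * cnj z))"
      by (simp only: Q_def norm_mult complex_mod_cnj norm_exp_eq_Re mult_minus_left uminus_complex.sel)
    also have "- Re ((z + h) * cnj z) = Re (t * (z + h)) + - (cmod (z + h))\<^sup>2 / 2 + Re (- t * z) + - (cmod z)\<^sup>2 / 2
        + ((cmod h)\<^sup>2 / 2 - Re (t * h))"
      unfolding Re_mult_cnj_shift by (simp add: field_simps)
    finally have "cmod (Q h z) = c h * (x * y)"
      by (simp only: c_def x_def y_def norm_mult norm_exp_eq_Re exp_add mult_ac)
    also have "\<dots> \<le> c h * (x\<^sup>2 + y\<^sup>2)"
    proof (rule mult_left_mono)
      have "0 \<le> x * y"
        by (simp add: x_def y_def)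
      then show "x * y \<le> x\<^sup>2 + y\<^sup>2"
        using sum_squares_bound[of x y] by linarith
    qed (simp add: c_def)
    also have "x\<^sup>2 = N1 (z + h)"
      by (simp add: x_def N1_def power_mult_distrib power2_eq_square[of "exp _"] mult_exp_exp)
    also have "y\<^sup>2 = N2 z"
      by (simp add: y_def N2_def power_mult_distrib power2_eq_square[of "exp _"] mult_exp_exp)
    finally show ?thesis .
  qed
  have bint: "integrable lborel (\<lambda>z. c h * (N1 (z + h) + N2 z))" for h
    using N1 N2 integrable_lborel_translate[of N1 h] by simp
  have Q_int: "integrable lborel (Q h)" for h
  proof (rule Bochner_Integration.integrable_bound[OF bint[of h]])
    show "Q h \<in> borel_measurable lborel"
      using Q_meas by simp
    show "AE z in lborel. norm (Q h z) \<le> norm (c h * (N1 (z + h) + N2 z))"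
      using bound by (intro AE_I2) (metis abs_ge_self order_trans real_norm_def)
  qed
  define K where "K = (LINT z|lborel. N1 z) + (LINT z|lborel. N2 z)"
  have K: "0 \<le> K"
    by (auto simp: K_def N1_def N2_def intro!: add_nonneg_nonneg integral_nonneg)
  have norm_Q: "(LINT z|lborel. cmod (Q h z)) \<le> c h * K" for h
  proof -
    have "(LINT z|lborel. cmod (Q h z)) \<le> (LINT z|lborel. c h * (N1 (z + h) + N2 z))"
      using Q_int bint bound by (intro integral_mono integrable_norm)
    also have "\<dots> = c h * K"
      using N1 N2 integrable_lborel_translate[of N1 h] integral_lborel_translate[of N1 h] by (simp add: K_def)
    finally show ?thesis .
  qed
  define J where "J h = (LINT z|lborel. Q h z)" for h
  define e where "e = h / 2"
  \<comment> \<open>In this form \<open>\<Phi>\<close> is a translate of \<open>Q\<close> with shift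
    \<open>Re \<zeta> * h\<close>, which gives its integral; the form \<open>\<Phi>_eq\<close> shows
    that it is holomorphic in \<zeta>.\<close>
  define \<Phi> where "\<Phi> z \<zeta> = Q (of_real (Re \<zeta>) * h) (z + (- (e * cnj \<zeta>)))" for z \<zeta>
  have \<Phi>_eq: "\<Phi> z \<zeta> = p (z + e * \<zeta>) * cnj (r (z - e * cnj \<zeta>)) * exp (- (z + e * \<zeta>) * (cnj z - cnj e * \<zeta>))" for z \<zeta>
  proof -
    have "complex_of_real (Re \<zeta>) * h = e * \<zeta> + e * cnj \<zeta>"
      by (simp only: distrib_left[symmetric] complex_add_cnj) (simp add: e_def)
    then show ?thesis
      by (simp add: \<Phi>_def Q_def)
  qed
  have \<Phi>_hol: "\<Phi> z holomorphic_on UNIV" for z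
    unfolding \<Phi>_eq[abs_def]
    by (intro holomorphic_intros holomorphic_cnj_reflect r holomorphic_on_compose_entire[OF p])
  have \<Phi>_int: "integrable lborel (\<lambda>z. \<Phi> z \<zeta>)" and \<Phi>_J: "(LINT z|lborel. \<Phi> z \<zeta>) = J (of_real (Re \<zeta>) * h)"
    and \<Phi>_norm: "(LINT z|lborel. cmod (\<Phi> z \<zeta>)) = (LINT z|lborel. cmod (Q (of_real (Re \<zeta>) * h) z))" for \<zeta>
    unfolding \<Phi>_def J_def
    by (simp_all only: Q_int integrable_lborel_translate[OF Q_meas] integral_lborel_translate[OF Q_meas]
        integral_lborel_translate[OF Q_norm_meas])
  \<comment> \<open>On the segments considered the shift has modulus at most
    \<open>2 * cmod h\<close>, so \<open>c\<close> is uniformly bounded there and Fubini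
    applies.\<close>
  have Fub: "(LINT z|lborel. LINT s|unit_interval_measure. \<Phi> z (a + b * of_real s))
        = (LINT s|unit_interval_measure. J (of_real (Re (a + b * of_real s)) * h))" (is ?eq)
      and Fub_int: "integrable lborel (\<lambda>z. LINT s|unit_interval_measure. \<Phi> z (a + b * of_real s))" (is ?int)
    if "cmod a \<le> 1" "cmod b \<le> 1" for a b
  proof -
    have "integrable (unit_interval_measure \<Otimes>\<^sub>M lborel) (\<lambda>(s, z). \<Phi> z (a + b * of_real s))"
    proof (rule unit_interval_lborel.Fubini_integrable)
      show "(\<lambda>(s, z). \<Phi> z (a + b * of_real s)) \<in> borel_measurable (unit_interval_measure \<Otimes>\<^sub>M lborel)"
        unfolding \<Phi>_def by measurable
      then have m: "(\<lambda>s. LINT z|lborel. cmod (\<Phi> z (a + b * of_real s))) \<in> borel_measurable unit_interval_measure"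
        by measurable
      show "integrable unit_interval_measure (\<lambda>s. LINT z|lborel. cmod (case (s, z) of (s, z) \<Rightarrow> \<Phi> z (a + b * of_real s)))"
      proof (simp only: prod.case, rule unit_interval.integrable_const_bound[OF _ m])
        show "AE s in unit_interval_measure. norm (LINT z|lborel. cmod (\<Phi> z (a + b * of_real s)))
            \<le> exp ((2 * cmod h)\<^sup>2 / 2 + cmod t * (2 * cmod h)) * K"
          using AE_unit_interval
        proof eventually_elim
          fix s :: real assume s: "0 \<le> s \<and> s \<le> 1"
          define h' where "h' = of_real (Re (a + b * of_real s)) * h"
          have "cmod (a + b * of_real s) \<le> cmod a + cmod b * s"
            using norm_triangle_ineq[of a "b * of_real s"] s by (simp add: norm_mult)
          also have "\<dots> \<le> 1 + 1 * 1"
            using that s by (intro add_mono mult_mono) auto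
          finally have "\<bar>Re (a + b * of_real s)\<bar> \<le> 2"
            using abs_Re_le_cmod[of "a + b * of_real s"] by linarith
          then have h': "cmod h' \<le> 2 * cmod h"
            unfolding h'_def norm_mult norm_of_real by (intro mult_right_mono) auto
          have "- Re (t * h') \<le> cmod t * cmod h'"
            using abs_Re_le_cmod[of "t * h'"] by (simp add: norm_mult)
          also have "\<dots> \<le> cmod t * (2 * cmod h)"
            using h' by (intro mult_left_mono) auto
          finally have "(cmod h')\<^sup>2 / 2 - Re (t * h') \<le> (2 * cmod h)\<^sup>2 / 2 + cmod t * (2 * cmod h)"
            using power_mono[OF h', of 2] by simp
          then have "c h' * K \<le> exp ((2 * cmod h)\<^sup>2 / 2 + cmod t * (2 * cmod h)) * K"
            unfolding c_def using K by (intro mult_right_mono) auto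
          with norm_Q[of h'] show "norm (LINT z|lborel. cmod (\<Phi> z (a + b * of_real s)))
            \<le> exp ((2 * cmod h)\<^sup>2 / 2 + cmod t * (2 * cmod h)) * K"
            unfolding \<Phi>_norm h'_def[symmetric] by simp
        qed
      qed
      show "AE s in unit_interval_measure. integrable lborel (\<lambda>z. case (s, z) of (s, z) \<Rightarrow> \<Phi> z (a + b * of_real s))"
        by (simp add: \<Phi>_int)
    qed
    from unit_interval_lborel.Fubini_integral[OF this] unit_interval_lborel.integrable_snd[OF this]
    show ?eq ?int
      by (simp_all only: \<Phi>_J)
  qed
  \<comment> \<open>On the vertical sides the real part is constantly 1 or 0, giving
    \<open>J h\<close> and \<open>J 0\<close>; the top and bottom run through the same real parts
    and cancel.\<close>
  have "\<i> * J h - \<i> * J 0 = \<i> * (LINT z|lborel. LINT s|unit_interval_measure. \<Phi> z (1 + \<i> * of_real s))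
      - \<i> * (LINT z|lborel. LINT s|unit_interval_measure. \<Phi> z (0 + \<i> * of_real s))"
    by (subst (1 2) Fub) simp_all
  also have "\<dots> = (LINT z|lborel. \<i> * (LINT s|unit_interval_measure. \<Phi> z (1 + \<i> * of_real s))
      - \<i> * (LINT s|unit_interval_measure. \<Phi> z (0 + \<i> * of_real s)))"
    using Fub_int[of 1 \<i>] Fub_int[of 0 \<i>] by simp
  also have "\<dots> = (LINT z|lborel. (LINT s|unit_interval_measure. \<Phi> z (\<i> + 1 * of_real s))
      - (LINT s|unit_interval_measure. \<Phi> z (0 + 1 * of_real s)))"
    by (simp only: rectangle_integral[OF \<Phi>_hol])
  also have "\<dots> = (LINT z|lborel. (LINT s|unit_interval_measure. \<Phi> z (\<i> + 1 * of_real s)))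
      - (LINT z|lborel. (LINT s|unit_interval_measure. \<Phi> z (0 + 1 * of_real s)))"
    using Fub_int[of \<i> 1] Fub_int[of 0 1] by (intro Bochner_Integration.integral_diff) auto
  also have "\<dots> = 0"
    by (subst (1 2) Fub) simp_all
  finally have "J h = J 0"
    by simp
  then show ?thesis
    by (simp add: J_def Q_def)
qed

text \<open>The motion \<alpha> z + \<beta> is forced by asking that \<phi> after it be the symbol
  \<open>cnj A * z + cnj D\<close> of \<open>V\<close>. The relation \<open>rel\<close> and equality
  of moduli then match the exponential weights as well.\<close>

lemma W_max_adjoint_rigid:
  fixes A B C D :: complex
  assumes f: "f holomorphic_on UNIV"
    and rel: "D * (1 - cnj A) = cnj B * (1 - A)" and BD: "cmod B = cmod D"
  defines "W \<equiv> weighted_comp (\<lambda>z. C * exp (D * z)) (\<lambda>z. A * z + B)"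
    and "V \<equiv> weighted_comp (\<lambda>z. cnj C * exp (cnj B * z)) (\<lambda>z. cnj A * z + cnj D)"
  shows "W f \<in> fock_space \<longleftrightarrow> V f \<in> fock_space" and "fock_norm (W f) = fock_norm (V f)"
proof -
  obtain \<alpha> \<beta> where \<alpha>: "cmod \<alpha> = 1" and A\<alpha>: "A * \<alpha> = cnj A" and A\<beta>: "A * \<beta> + B = cnj D"
    and D: "D = cnj B * cnj \<alpha> + cnj \<beta>"
  proof (cases "A = 0")
    case True
    then have "D = cnj B"
      using rel by simp
    then show ?thesis
      \<comment> \<open>For \<open>A = 0\<close> the relation gives \<open>D = cnj B\<close>, both
        symbols are the constant \<open>B\<close>, and the identity motion works.\<close>
      using that[of 1 0] True by simp
  next
    case False
    have "cnj B * cnj (cnj A / A) + cnj ((cnj D - B) / A) = (D - cnj B * (1 - A)) / cnj A"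
      using False by (simp add: field_simps)
    also have "\<dots> = D"
      using False by (simp add: rel[symmetric] field_simps)
    finally show ?thesis
      using that[of "cnj A / A" "(cnj D - B) / A"] False by (simp add: norm_divide)
  qed
  have \<alpha>': "\<alpha> * cnj \<alpha> = 1"
    using \<alpha> by (metis complex_norm_square of_real_1 one_power2)
  \<comment> \<open>Equality of the logarithms of the two weights. The terms depending on
    \<open>z\<close> match through the formula for \<open>D\<close>, and the constant term is
    \<open>(cmod D)\<^sup>2 - (cmod B)\<^sup>2\<close>.\<close>
  have E: "2 * Re (D * (\<alpha> * z + \<beta>)) - (cmod (\<alpha> * z + \<beta>))\<^sup>2 = 2 * Re (cnj B * z) - (cmod z)\<^sup>2" for z
  proof -
    have "complex_of_real (2 * Re (D * (\<alpha> * z + \<beta>)) - (cmod (\<alpha> * z + \<beta>))\<^sup>2)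
        = D * (\<alpha> * z + \<beta>) + cnj (D * (\<alpha> * z + \<beta>)) - (\<alpha> * z + \<beta>) * cnj (\<alpha> * z + \<beta>)"
      by (simp only: of_real_diff complex_norm_square complex_add_cnj of_real_mult of_real_numeral)
    also have "\<dots> = (cnj B * z + cnj (cnj B * z)) * (\<alpha> * cnj \<alpha>) - z * cnj z * (\<alpha> * cnj \<alpha>)
        + (D * \<beta> + cnj (D * \<beta>) - \<beta> * cnj \<beta>)"
      by (simp add: D algebra_simps)
    also have "D * \<beta> + cnj (D * \<beta>) - \<beta> * cnj \<beta> = D * cnj D - (D - cnj \<beta>) * cnj (D - cnj \<beta>)"
      by (simp add: algebra_simps)
    also have "\<dots> = D * cnj D - B * cnj B * (\<alpha> * cnj \<alpha>)"
      by (simp add: D)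
    also have "\<dots> = complex_of_real ((cmod D)\<^sup>2) - complex_of_real ((cmod B)\<^sup>2)"
      by (simp only: \<alpha>' mult_1_right complex_norm_square)
    also have "\<dots> = 0"
      by (simp add: BD)
    also have "(cnj B * z + cnj (cnj B * z)) * (\<alpha> * cnj \<alpha>) - z * cnj z * (\<alpha> * cnj \<alpha>) + 0
        = complex_of_real (2 * Re (cnj B * z) - (cmod z)\<^sup>2)"
      unfolding \<alpha>' mult_1_right add_0_right
      by (simp only: of_real_diff complex_norm_square complex_add_cnj of_real_mult of_real_numeral)
    finally show ?thesis
      by (simp only: of_real_eq_iff)
  qed
  have hol: "W f holomorphic_on UNIV" "V f holomorphic_on UNIV"
    unfolding W_def V_def weighted_comp_def
    by (intro holomorphic_intros holomorphic_on_compose_entire[OF f])+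
  define F where "F z = (cmod (W f z))\<^sup>2 * exp (- (cmod z)\<^sup>2)" for z
  have F: "F \<in> borel_measurable borel"
    using holomorphic_borel_measurable[OF hol(1)] unfolding F_def by measurable
  have exp2: "(exp x)\<^sup>2 = exp (2 * x)" for x :: real
    by (simp add: power2_eq_square mult_exp_exp)
  have FV: "F (\<alpha> * z + \<beta>) = (cmod (V f z))\<^sup>2 * exp (- (cmod z)\<^sup>2)" for z
  proof -
    have arg: "A * (\<alpha> * z + \<beta>) + B = cnj A * z + cnj D"
      by (simp add: distrib_left A\<alpha>[symmetric] A\<beta>[symmetric] mult.assoc add.assoc)
    have "F (\<alpha> * z + \<beta>) = (cmod C)\<^sup>2 * (cmod (f (cnj A * z + cnj D)))\<^sup>2
        * exp (2 * Re (D * (\<alpha> * z + \<beta>)) + - (cmod (\<alpha> * z + \<beta>))\<^sup>2)"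
      unfolding F_def W_def weighted_comp_def arg
      by (simp only: norm_mult norm_exp_eq_Re power_mult_distrib exp2 exp_add mult_ac)
    also have "\<dots> = (cmod C)\<^sup>2 * (cmod (f (cnj A * z + cnj D)))\<^sup>2 * exp (2 * Re (cnj B * z) + - (cmod z)\<^sup>2)"
      using E[of z] by simp
    also have "\<dots> = (cmod (V f z))\<^sup>2 * exp (- (cmod z)\<^sup>2)"
      unfolding V_def weighted_comp_def
      by (simp only: norm_mult complex_mod_cnj norm_exp_eq_Re power_mult_distrib exp2 exp_add mult_ac)
    finally show ?thesis .
  qed
  show "W f \<in> fock_space \<longleftrightarrow> V f \<in> fock_space"
    using integrable_lborel_rigid[OF \<alpha> F, of \<beta>] hol unfolding FV by (simp add: fock_space_def F_def[abs_def])
  show "fock_norm (W f) = fock_norm (V f)"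
    using integral_lborel_rigid[OF \<alpha> F, of \<beta>] unfolding FV by (simp add: fock_norm_eq F_def[abs_def])
qed

section \<open>The adjoint identity on the maximal domains\<close>

lemma exp_cmod_power2: "complex_of_real (exp (- (cmod z)\<^sup>2)) = exp (- (z * cnj z))"
  by (simp only: exp_of_real[symmetric] of_real_minus complex_norm_square)

text \<open>Conjugation by the Weyl translation to the fixed point \<open>c\<close> of \<open>\<phi>\<close> turns both operators into dilations.\<close>

lemma W_max_adjoint_fixed_point:
  fixes A B C D :: complex
  assumes f: "f \<in> fock_space" and g: "g \<in> fock_space"
    and rel: "D * (1 - cnj A) = cnj B * (1 - A)" and A: "A \<noteq> 1"
  defines "W \<equiv> weighted_comp (\<lambda>z. C * exp (D * z)) (\<lambda>z. A * z + B)"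
    and "V \<equiv> weighted_comp (\<lambda>z. cnj C * exp (cnj B * z)) (\<lambda>z. cnj A * z + cnj D)"
  assumes Wf: "W f \<in> fock_space" and Vg: "V g \<in> fock_space"
  shows "fock_inner (W f) g = fock_inner f (V g)"
proof -
  define c where "c = B / (1 - A)"
  have A': "1 - A \<noteq> 0" "1 - cnj A \<noteq> 0"
    using A by (auto simp: complex_eq_iff)
  have B: "B = c * (1 - A)"
    using A' by (simp add: c_def)
  \<comment> \<open>Equivalently, \<open>c\<close> is also fixed by the symbol
    \<open>cnj A * z + cnj D\<close> of \<open>V\<close>, so one translation serves both
    operators.\<close>
  have D: "D = cnj c * (1 - A)"
    using rel A' by (simp add: B)
  \<comment> \<open>All constant factors produced by the translation are collected in
    \<open>F\<close>, so that \<open>G\<close> carries none.\<close>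
  define F where "F z = C * exp (D * c - c * cnj c) * f (z + c) * exp (- (z * cnj c))" for z
  define G where "G z = g (z + c) * exp (- (z * cnj c))" for z
  have F: "F holomorphic_on UNIV" and G: "G holomorphic_on UNIV"
    unfolding F_def G_def
    by (intro holomorphic_intros holomorphic_on_compose_entire[OF fock_space_holomorphic[OF f]]
        holomorphic_on_compose_entire[OF fock_space_holomorphic[OF g]])+
  define I1 where "I1 z = W f z * cnj (g z) * of_real (exp (- (cmod z)\<^sup>2))" for z
  define I2 where "I2 z = f z * cnj (V g z) * of_real (exp (- (cmod z)\<^sup>2))" for z
  note [measurable] = f[THEN fock_space_measurable] g[THEN fock_space_measurable]
    Wf[THEN fock_space_measurable] Vg[THEN fock_space_measurable]
  have meas: "I1 \<in> borel_measurable borel" "I2 \<in> borel_measurable borel"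
    unfolding I1_def I2_def by measurable
  have int: "integrable lborel I1" "integrable lborel I2"
    unfolding I1_def I2_def using f g Wf Vg by (simp_all only: fock_inner_integrable)
  have 1: "I1 (z + c) = F (A * z) * cnj (G z) * of_real (exp (- (cmod z)\<^sup>2))" for z
  proof -
    have arg: "A * (z + c) + B = A * z + c"
      by (simp add: B algebra_simps)
    have "D * (z + c) - (z + c) * cnj (z + c) = (D * c - c * cnj c) + - (A * z * cnj c) + - (cnj z * c) + - (z * cnj z)"
      by (simp add: D algebra_simps)
    then have "exp (D * (z + c)) * exp (- ((z + c) * cnj (z + c)))
        = exp (D * c - c * cnj c) * exp (- (A * z * cnj c)) * exp (- (cnj z * c)) * exp (- (z * cnj z))"
      by (simp only: exp_add[symmetric] diff_conv_add_uminus)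
    then have "C * f (A * z + c) * cnj (g (z + c)) * (exp (D * (z + c)) * exp (- ((z + c) * cnj (z + c))))
        = C * f (A * z + c) * cnj (g (z + c)) * (exp (D * c - c * cnj c) * exp (- (A * z * cnj c)) * exp (- (cnj z * c)) * exp (- (z * cnj z)))"
      by (rule arg_cong)
    then show ?thesis
      unfolding I1_def W_def weighted_comp_def arg F_def G_def exp_cmod_power2
      by (simp only: complex_cnj_mult exp_cnj complex_cnj_minus complex_cnj_cnj mult_ac)
  qed
  have 2: "I2 (z + c) = F z * cnj (G (cnj A * z)) * of_real (exp (- (cmod z)\<^sup>2))" for z
  proof -
    have arg: "cnj A * (z + c) + cnj D = cnj A * z + c"
      by (simp add: D algebra_simps)
    have "B * cnj (z + c) - (z + c) * cnj (z + c) = (D * c - c * cnj c) + - (z * cnj c) + - (A * cnj z * c) + - (z * cnj z)"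
      by (simp add: B D algebra_simps)
    then have "exp (B * cnj (z + c)) * exp (- ((z + c) * cnj (z + c)))
        = exp (D * c - c * cnj c) * exp (- (z * cnj c)) * exp (- (A * cnj z * c)) * exp (- (z * cnj z))"
      by (simp only: exp_add[symmetric] diff_conv_add_uminus)
    then have "C * f (z + c) * cnj (g (cnj A * z + c)) * (exp (B * cnj (z + c)) * exp (- ((z + c) * cnj (z + c))))
        = C * f (z + c) * cnj (g (cnj A * z + c)) * (exp (D * c - c * cnj c) * exp (- (z * cnj c)) * exp (- (A * cnj z * c)) * exp (- (z * cnj z)))"
      by (rule arg_cong)
    then show ?thesis
      unfolding I2_def V_def weighted_comp_def arg F_def G_def exp_cmod_power2
      by (simp only: complex_cnj_mult exp_cnj complex_cnj_minus complex_cnj_cnj mult_ac)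
  qed
  have "(LINT z|lborel. I1 z) = (LINT z|lborel. I1 (z + c))"
    by (rule integral_lborel_translate[OF meas(1), symmetric])
  also have "\<dots> = (LINT z|lborel. I2 (z + c))"
    unfolding 1 2
  proof (rule dilation_adjoint[OF F G])
    show "integrable lborel (\<lambda>z. F (A * z) * cnj (G z) * of_real (exp (- (cmod z)\<^sup>2)))"
      unfolding 1[symmetric] integrable_lborel_translate[OF meas(1)] by (rule int)
    show "integrable lborel (\<lambda>z. F z * cnj (G (cnj A * z)) * of_real (exp (- (cmod z)\<^sup>2)))"
      unfolding 2[symmetric] integrable_lborel_translate[OF meas(2)] by (rule int)
  qed
  also have "\<dots> = (LINT z|lborel. I2 z)"
    by (rule integral_lborel_translate[OF meas(2)])
  finally show ?thesis
    unfolding fock_inner_def I1_def I2_def by simp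
qed

text \<open>Undoing the translation in the norm of the image shows that
  \<open>f z * exp (2 * s * z)\<close> is square integrable. Since
  \<open>exp (2 * x) \<le> 1 + exp (4 * x)\<close>, the function with half that exponent is
  controlled by this and by \<open>f\<close> itself.\<close>

lemma fock_space_exp_interpolation:
  assumes f: "f \<in> fock_space" and C: "C \<noteq> 0"
    and Wf: "weighted_comp (\<lambda>z. C * exp (D * z)) (\<lambda>z. z + B) f \<in> fock_space"
  shows "(\<lambda>z. f z * exp ((D + cnj B) / 2 * z)) \<in> fock_space"
proof (rule fock_spaceI)
  define s where "s = (D + cnj B) / 2"
  show "(\<lambda>z. f z * exp ((D + cnj B) / 2 * z)) holomorphic_on UNIV"
    by (intro holomorphic_intros fock_space_holomorphic[OF f]) auto
  note [measurable] = fock_space_measurable[OF f]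
  define F where "F z = (cmod (C * exp (D * z) * f (z + B)))\<^sup>2 * exp (- (cmod z)\<^sup>2)" for z
  have F_meas: "F \<in> borel_measurable borel"
    unfolding F_def by measurable
  have "integrable lborel F"
    using fock_space_integrable[OF Wf] by (simp add: weighted_comp_def F_def[abs_def])
  then have int: "integrable lborel (\<lambda>z. F (z + (- B)))"
    by (simp only: integrable_lborel_translate[OF F_meas])
  define \<kappa> where "\<kappa> = (cmod C)\<^sup>2 * exp (- 2 * Re (D * B) - (cmod B)\<^sup>2)"
  have \<kappa>: "\<kappa> > 0"
    using C by (simp add: \<kappa>_def)
  have exp2: "(exp x)\<^sup>2 = exp (2 * x)" for x :: real
    by (simp add: power2_eq_square mult_exp_exp)
  have F_eq: "F (z + (- B)) = \<kappa> * ((cmod (f z))\<^sup>2 * exp (4 * Re (s * z)) * exp (- (cmod z)\<^sup>2))" for z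
  proof -
    have "2 * Re (D * (z + - B)) + - (cmod (z + - B))\<^sup>2
        = (- 2 * Re (D * B) - (cmod B)\<^sup>2) + 4 * Re (s * z) + - (cmod z)\<^sup>2"
      unfolding cmod_power2 s_def by (simp add: field_simps power2_eq_square)
    then have *: "exp (2 * Re (D * (z + - B))) * exp (- (cmod (z + - B))\<^sup>2)
        = exp (- 2 * Re (D * B) - (cmod B)\<^sup>2) * exp (4 * Re (s * z)) * exp (- (cmod z)\<^sup>2)"
      by (simp only: exp_add[symmetric])
    have "F (z + (- B)) = (cmod C)\<^sup>2 * (cmod (f z))\<^sup>2 * (exp (2 * Re (D * (z + - B))) * exp (- (cmod (z + - B))\<^sup>2))"
      unfolding F_def norm_mult norm_exp_eq_Re power_mult_distrib exp2 by simp
    then show ?thesis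
      unfolding * \<kappa>_def by (simp only: mult_ac)
  qed
  have int4: "integrable lborel (\<lambda>z. (cmod (f z))\<^sup>2 * exp (4 * Re (s * z)) * exp (- (cmod z)\<^sup>2))"
    using int \<kappa> unfolding F_eq by (subst (asm) integrable_mult_left_iff) simp
  show "integrable lborel (\<lambda>z. (cmod (f z * exp ((D + cnj B) / 2 * z)))\<^sup>2 * exp (- (cmod z)\<^sup>2))"
  proof (rule Bochner_Integration.integrable_bound)
    show "integrable lborel (\<lambda>z. (cmod (f z))\<^sup>2 * exp (- (cmod z)\<^sup>2)
        + (cmod (f z))\<^sup>2 * exp (4 * Re (s * z)) * exp (- (cmod z)\<^sup>2))"
      using fock_space_integrable[OF f] int4 by (rule Bochner_Integration.integrable_add)
    have "(cmod (f z * exp (s * z)))\<^sup>2 * exp (- (cmod z)\<^sup>2)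
        \<le> (cmod (f z))\<^sup>2 * exp (- (cmod z)\<^sup>2) + (cmod (f z))\<^sup>2 * exp (4 * Re (s * z)) * exp (- (cmod z)\<^sup>2)" for z
    proof -
      define x where "x = Re (s * z)"
      have "exp (2 * x) \<le> 1 + exp (4 * x)"
      proof (cases "x \<le> 0")
        case True
        then show ?thesis
          using exp_le_one_iff[of "2 * x"] exp_gt_zero[of "4 * x"] by linarith
      next
        case False
        then have "exp (2 * x) \<le> exp (4 * x)"
          by simp
        then show ?thesis
          by linarith
      qed
      then have "(cmod (f z))\<^sup>2 * exp (2 * x) * exp (- (cmod z)\<^sup>2) \<le> (cmod (f z))\<^sup>2 * (1 + exp (4 * x)) * exp (- (cmod z)\<^sup>2)"
        by (intro mult_right_mono mult_left_mono) auto
      then show ?thesis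
        unfolding norm_mult norm_exp_eq_Re power_mult_distrib exp2 x_def by (simp add: distrib_left distrib_right)
    qed
    then show "AE z in lborel. norm ((cmod (f z * exp ((D + cnj B) / 2 * z)))\<^sup>2 * exp (- (cmod z)\<^sup>2))
        \<le> norm ((cmod (f z))\<^sup>2 * exp (- (cmod z)\<^sup>2) + (cmod (f z))\<^sup>2 * exp (4 * Re (s * z)) * exp (- (cmod z)\<^sup>2))"
      unfolding s_def[symmetric] real_norm_def by (intro AE_I2) (simp add: order_trans[OF _ abs_ge_self])
  qed measurable
qed

text \<open>Up to the common factor \<open>\<kappa>\<close> and a translation, both inner products
  are twisted pairings of \<open>p\<close> with \<open>r\<close>, at shifts \<open>B\<close> and
  \<open>- cnj D\<close>; independence of the shift equates them.\<close>

lemma W_max_adjoint_translation: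
  fixes B C D :: complex
  assumes f: "f \<in> fock_space" and g: "g \<in> fock_space" and C: "C \<noteq> 0"
  defines "W \<equiv> weighted_comp (\<lambda>z. C * exp (D * z)) (\<lambda>z. z + B)"
    and "V \<equiv> weighted_comp (\<lambda>z. cnj C * exp (cnj B * z)) (\<lambda>z. z + cnj D)"
  assumes Wf: "W f \<in> fock_space" and Vg: "V g \<in> fock_space"
  shows "fock_inner (W f) g = fock_inner f (V g)"
proof -
  define s where "s = (D + cnj B) / 2"
  define p where "p z = f z * exp (D * z)" for z
  define r where "r z = g z * exp (cnj B * z)" for z
  have p: "p holomorphic_on UNIV" and r: "r holomorphic_on UNIV"
    unfolding p_def r_def
    by (intro holomorphic_intros fock_space_holomorphic[OF f] fock_space_holomorphic[OF g])+
  \<comment> \<open>As \<open>D + cnj B = 2 * s\<close>, the factors with \<open>s - D\<close> and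
    its negative turn \<open>p\<close> and \<open>r\<close> into \<open>f\<close> and
    \<open>g\<close> times the same \<open>exp (s * z)\<close>, the midpoint reached by
    interpolation.\<close>
  have P: "(\<lambda>z. p z * exp ((s - D) * z)) \<in> fock_space"
  proof -
    have "(\<lambda>z. p z * exp ((s - D) * z)) = (\<lambda>z. f z * exp ((D + cnj B) / 2 * z))"
      unfolding p_def mult.assoc exp_add[symmetric] s_def by (simp add: algebra_simps)
    then show ?thesis
      using fock_space_exp_interpolation[OF f C] Wf by (simp add: W_def)
  qed
  have R: "(\<lambda>z. r z * exp (- (s - D) * z)) \<in> fock_space"
  proof -
    have "cnj B * z + - (s - D) * z = (cnj B + cnj (cnj D)) / 2 * z" for z
      by (simp add: s_def field_simps)
    then have "(\<lambda>z. r z * exp (- (s - D) * z)) = (\<lambda>z. g z * exp ((cnj B + cnj (cnj D)) / 2 * z))"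
      by (simp only: r_def mult.assoc exp_add[symmetric])
    then show ?thesis
      using fock_space_exp_interpolation[OF g _ Vg[unfolded V_def]] C by (simp only: complex_cnj_zero_iff not_False_eq_True)
  qed
  define Q where "Q h z = p (z + h) * cnj (r z) * exp (- (z + h) * cnj z)" for h z
  note [measurable] = p[THEN holomorphic_borel_measurable] r[THEN holomorphic_borel_measurable]
  have Q_meas: "Q h \<in> borel_measurable borel" for h
    unfolding Q_def by measurable
  have Q: "(LINT z|lborel. Q h z) = (LINT z|lborel. Q 0 z)" for h
    using integral_twisted_translate[OF p r P R, of h] by (simp add: Q_def)
  define \<kappa> where "\<kappa> = C * exp (- (D * B))"
  have 1: "W f z * cnj (g z) * of_real (exp (- (cmod z)\<^sup>2)) = \<kappa> * Q B z" for z
  proof -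
    have "- (D * B) + D * (z + B) + B * cnj z + - (z + B) * cnj z = D * z + - (z * cnj z)"
      by (simp add: algebra_simps)
    then have "exp (- (D * B)) * exp (D * (z + B)) * exp (B * cnj z) * exp (- (z + B) * cnj z) = exp (D * z) * exp (- (z * cnj z))"
      by (simp only: exp_add[symmetric])
    then have "C * f (z + B) * cnj (g z) * (exp (- (D * B)) * exp (D * (z + B)) * exp (B * cnj z) * exp (- (z + B) * cnj z))
        = C * f (z + B) * cnj (g z) * (exp (D * z) * exp (- (z * cnj z)))"
      by (rule arg_cong)
    then show ?thesis
      unfolding W_def weighted_comp_def \<kappa>_def Q_def p_def r_def exp_cmod_power2
      by (simp only: complex_cnj_mult exp_cnj complex_cnj_cnj mult_ac)
  qed
  have 2: "f z * cnj (V g z) * of_real (exp (- (cmod z)\<^sup>2)) = \<kappa> * Q (- cnj D) (z + cnj D)" for z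
  proof -
    have "- (D * B) + D * z + B * cnj (z + cnj D) + - z * cnj (z + cnj D) = B * cnj z + - (z * cnj z)"
      by (simp add: algebra_simps)
    then have "exp (- (D * B)) * exp (D * z) * exp (B * cnj (z + cnj D)) * exp (- z * cnj (z + cnj D)) = exp (B * cnj z) * exp (- (z * cnj z))"
      by (simp only: exp_add[symmetric])
    then have "C * f z * cnj (g (z + cnj D)) * (exp (- (D * B)) * exp (D * z) * exp (B * cnj (z + cnj D)) * exp (- z * cnj (z + cnj D)))
        = C * f z * cnj (g (z + cnj D)) * (exp (B * cnj z) * exp (- (z * cnj z)))"
      by (rule arg_cong)
    moreover have "z + cnj D + - cnj D = z"
      by simp
    ultimately show ?thesis
      unfolding V_def weighted_comp_def \<kappa>_def Q_def p_def r_def exp_cmod_power2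
      by (simp only: complex_cnj_mult exp_cnj complex_cnj_cnj mult_ac)
  qed
  have "(LINT z|lborel. \<kappa> * Q B z) = (LINT z|lborel. \<kappa> * Q (- cnj D) (z + cnj D))"
    by (simp only: integral_mult_right_zero integral_lborel_translate[OF Q_meas] Q[of B] Q[of "- cnj D"])
  then show ?thesis
    unfolding fock_inner_def 1 2 by simp
qed

text \<open>The adjoint is identified with \<open>V\<close> on its maximal domain: the adjoint
  identity gives one inclusion, testing against kernels the other. The rigid motion then matches
  domain and norms with those of \<open>W\<close>.\<close>

lemma normal_W_max_affine_exp:
  assumes \<phi>: "\<And>z. \<phi> z = A * z + B" and \<psi>: "\<And>z. \<psi> z = C * exp (D * z)" and C: "C \<noteq> 0"
    and rel: "D * (1 - cnj A) = cnj B * (1 - A)" and BD: "cmod B = cmod D"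
  shows "normal_operator (W_max \<psi> \<phi>)"
proof -
  define W where "W = weighted_comp (\<lambda>z. C * exp (D * z)) (\<lambda>z. A * z + B)"
  define V where "V = weighted_comp (\<lambda>z. cnj C * exp (cnj B * z)) (\<lambda>z. cnj A * z + cnj D)"
  have W: "weighted_comp \<psi> \<phi> = W"
    unfolding W_def weighted_comp_def \<phi> \<psi> ..
  have dd: "densely_defined (W_max \<psi> \<phi>)"
    by (rule densely_defined_W_max_affine[OF \<psi> \<phi>])
  have WV: "W f \<in> fock_space \<longleftrightarrow> V f \<in> fock_space" and WV_norm: "fock_norm (W f) = fock_norm (V f)"
    if "f \<in> fock_space" for f
    unfolding W_def V_def using W_max_adjoint_rigid[OF fock_space_holomorphic[OF that] rel BD] by auto
  have adj: "fock_inner (W f) g = fock_inner f (V g)"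
    if "f \<in> fock_space" "g \<in> fock_space" "W f \<in> fock_space" "V g \<in> fock_space" for f g
  proof (cases "A = 1")
    case True
    show ?thesis
      using W_max_adjoint_translation[OF that(1,2) C, of D B] that(3,4) True by (simp add: W_def V_def)
  next
    case False
    show ?thesis
      using W_max_adjoint_fixed_point[OF that(1,2) rel False, of C] that(3,4) by (simp add: W_def V_def)
  qed
  have adj_W: "g \<in> op_dom (adjoint_op (W_max \<psi> \<phi>)) \<and> op_app (adjoint_op (W_max \<psi> \<phi>)) g = V g"
    if "g \<in> fock_space" "V g \<in> fock_space" for g
    using op_dom_adjointI[OF dd that] op_app_adjoint_eq[OF dd that] adj that
    by (auto simp: op_dom_W_max op_app_W_max W)
  have dom_adj: "V g \<in> fock_space" if g: "g \<in> op_dom (adjoint_op (W_max \<psi> \<phi>))" for g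
  proof -
    obtain h where h: "h \<in> fock_space"
        "\<And>f. f \<in> op_dom (W_max \<psi> \<phi>) \<Longrightarrow> fock_inner (op_app (W_max \<psi> \<phi>) f) g = fock_inner f h"
      and g': "g \<in> fock_space"
      using g by (auto simp: adjoint_op_def op_dom_def)
    \<comment> \<open>\<open>W\<close> maps each kernel to a multiple of a kernel, so reproducing on
      both sides computes the representing element \<open>h\<close> pointwise.\<close>
    have "h w = V g w" for w
    proof -
      have Wk: "W (fock_kernel w) = (\<lambda>z. C * exp (B * cnj w) * fock_kernel (cnj A * w + cnj D) z)"
        unfolding W_def weighted_comp_def fock_kernel_def mult.assoc exp_add[symmetric]
        by (simp add: algebra_simps)
      then have "fock_kernel w \<in> op_dom (W_max \<psi> \<phi>)"
        by (simp add: op_dom_W_max W fock_space_cmult)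
      then have "fock_inner (fock_kernel w) h = fock_inner (W (fock_kernel w)) g"
        using h(2) by (simp add: op_app_W_max W)
      then have "fock_inner h (fock_kernel w) = fock_inner g (W (fock_kernel w))"
        by (metis fock_inner_commute)
      also have "\<dots> = V g w"
        unfolding Wk fock_inner_cmult_right fock_reproducing[OF g'] V_def weighted_comp_def
        by (simp add: exp_cnj)
      finally show ?thesis
        by (simp add: fock_reproducing h(1))
    qed
    then have "V g = h"
      by auto
    then show ?thesis
      using h by simp
  qed
  have dom_eq: "op_dom (W_max \<psi> \<phi>) = op_dom (adjoint_op (W_max \<psi> \<phi>))"
  proof (intro equalityI subsetI)
    fix f assume "f \<in> op_dom (W_max \<psi> \<phi>)"
    then show "f \<in> op_dom (adjoint_op (W_max \<psi> \<phi>))"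
      using adj_W WV by (auto simp: op_dom_W_max W)
  next
    fix f assume f: "f \<in> op_dom (adjoint_op (W_max \<psi> \<phi>))"
    then have "f \<in> fock_space"
      by (auto simp: adjoint_op_def op_dom_def)
    then show "f \<in> op_dom (W_max \<psi> \<phi>)"
      using dom_adj[OF f] WV by (auto simp: op_dom_W_max W)
  qed
  have "fock_norm (op_app (W_max \<psi> \<phi>) f) = fock_norm (op_app (adjoint_op (W_max \<psi> \<phi>)) f)"
    if "f \<in> op_dom (W_max \<psi> \<phi>)" for f
    using that adj_W WV WV_norm by (auto simp: op_dom_W_max op_app_W_max W)
  then show ?thesis
    using closed_operator_W_max dd dom_eq by (auto simp: normal_operator_def)
qed

theorem theorem6p3:
  fixes \<phi> \<psi> :: "complex \<Rightarrow> complex"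
  assumes "\<phi> holomorphic_on UNIV" and "\<psi> holomorphic_on UNIV"
    and "\<exists>z. \<psi> z \<noteq> 0"
  shows "normal_operator (W_max \<psi> \<phi>) \<longleftrightarrow>
    (\<exists>A B C D :: complex.
       ((\<forall>z. \<phi> z = A * z + B) \<and> A \<noteq> 1 \<and> (\<forall>z. \<psi> z = C * exp (D * z)) \<and>
          D = cnj B * (1 - A) * inverse (1 - cnj A))
     \<or> ((\<forall>z. \<phi> z = z + B) \<and> (\<forall>z. \<psi> z = C * exp (D * z)) \<and> cmod B = cmod D))"
proof
  assume "normal_operator (W_max \<psi> \<phi>)"
  from normal_W_max_imp_form[OF assms(1,2) this assms(3)]
  obtain A B C D where "\<And>z. \<phi> z = A * z + B" "\<And>z. \<psi> z = C * exp (D * z)"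
      "A \<noteq> 1 \<Longrightarrow> D = cnj B * (1 - A) * inverse (1 - cnj A)" "A = 1 \<Longrightarrow> cmod B = cmod D"
    by blast
  then show "\<exists>A B C D :: complex.
       ((\<forall>z. \<phi> z = A * z + B) \<and> A \<noteq> 1 \<and> (\<forall>z. \<psi> z = C * exp (D * z)) \<and>
          D = cnj B * (1 - A) * inverse (1 - cnj A))
     \<or> ((\<forall>z. \<phi> z = z + B) \<and> (\<forall>z. \<psi> z = C * exp (D * z)) \<and> cmod B = cmod D)"
    by (cases "A = 1") (metis mult_1_left, metis)
next
  assume "\<exists>A B C D :: complex.
       ((\<forall>z. \<phi> z = A * z + B) \<and> A \<noteq> 1 \<and> (\<forall>z. \<psi> z = C * exp (D * z)) \<and>
          D = cnj B * (1 - A) * inverse (1 - cnj A))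
     \<or> ((\<forall>z. \<phi> z = z + B) \<and> (\<forall>z. \<psi> z = C * exp (D * z)) \<and> cmod B = cmod D)"
  then obtain A B C D :: complex where
    "((\<forall>z. \<phi> z = A * z + B) \<and> A \<noteq> 1 \<and> (\<forall>z. \<psi> z = C * exp (D * z)) \<and>
          D = cnj B * (1 - A) * inverse (1 - cnj A))
     \<or> ((\<forall>z. \<phi> z = z + B) \<and> (\<forall>z. \<psi> z = C * exp (D * z)) \<and> cmod B = cmod D)"
    by blast
  then show "normal_operator (W_max \<psi> \<phi>)"
  proof (elim disjE conjE)
    assume \<phi>: "\<forall>z. \<phi> z = A * z + B" and A: "A \<noteq> 1" and \<psi>: "\<forall>z. \<psi> z = C * exp (D * z)"
      and D: "D = cnj B * (1 - A) * inverse (1 - cnj A)"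
    have A': "1 - A \<noteq> 0" "1 - cnj A \<noteq> 0"
      using A by (auto simp: complex_eq_iff)
    \<comment> \<open>The formula for \<open>D\<close> multiplies \<open>cnj B\<close> by a number
      of modulus 1, so equality of moduli holds in this case too and one lemma covers both
      cases.\<close>
    have "cmod (1 - cnj A) = cmod (1 - A)"
      by (metis complex_cnj_diff complex_cnj_one complex_mod_cnj)
    then have "cmod B = cmod D"
      using A' by (simp add: D norm_mult norm_inverse)
    moreover have "D * (1 - cnj A) = cnj B * (1 - A)"
      using A' by (simp add: D)
    moreover have "C \<noteq> 0"
      using assms(3) \<psi> by auto
    ultimately show ?thesis
      using \<phi> \<psi> by (intro normal_W_max_affine_exp[of \<phi> A B \<psi> C D]) auto
  next
    assume \<phi>: "\<forall>z. \<phi> z = z + B" and \<psi>: "\<forall>z. \<psi> z = C * exp (D * z)" and BD: "cmod B = cmod D"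
    moreover have "C \<noteq> 0"
      using assms(3) \<psi> by auto
    \<comment> \<open>With \<open>A = 1\<close> both sides of the relation between \<open>D\<close>
      and \<open>B\<close> are 0.\<close>
    ultimately show ?thesis
      by (intro normal_W_max_affine_exp[of \<phi> 1 B \<psi> C D]) auto
  qed
qed

end
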